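(* If $0<\varepsilon<\frac{\pi}{n-2}$, then $F_2(\varepsilon,n)=O(n^2\varepsilon^2)$. Consequently, if $\varepsilon=O(1/n^2)$ as $n\to\infty$, then $F_2(\varepsilon,n)=O(\varepsilon)$.
   Context: A Steiner topology for $n$ terminals is a (graph-theoretic) tree $\mathcal{T}$ with $n$ special vertices $t_1,\dots,t_n$, called terminals, all of degree at most $3$, and all other vertices, called Steiner points, of degree exactly $3$. It is full if all terminals have degree $1$. Given a family $p_1,\dots,p_n$ of points in $\mathbb{R}^d$ (repetitions allowed), a Steiner tree with topology $\mathcal{T}$ on these points is a representation of $\mathcal{T}$ in $\mathbb{R}^d$ in which $t_i$ is represented by $p_i$, each Steiner point by an arbitrary point of $\mathbb{R}^d$, and each edge by a straight-line segment. Steiner points may coincide with each other and with terminals (so edges incident to a Steiner point may have length $0$; such edges, and trees containing them, are called degenerate), and edges may cross. A Steiner tree is full if its topology is full. The length $L(T)$ of a tree $T$ is the sum of the Euclidean lengths of its edges. Angles are measured in $[0,\pi]$. For $\varepsilon\geq 0$, an $\varepsilon$-approximate Steiner tree is a tree with a Steiner topology, with all the angles spanned by the edges at each Steiner point belonging to the interval $[2\pi/3-\varepsilon,2\pi/3+\varepsilon]$. For $d\geq 2$, $n\geq 3$ and $\varepsilon\geq 0$, $\mathcal{A}_\varepsilon^d(n)$ denotes the set of all full $\varepsilon$-approximate Steiner trees on $n$ terminals in $\mathbb{R}^d$. For a tree $T$ in $\mathbb{R}^d$ with Steiner topology $\mathcal{T}$, $S(T)$ denotes the (unique) shortest tree in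 $\mathbb{R}^d$ on the terminals of $T$ with topology $\mathcal{T}$, where degenerate shortest trees are allowed. Define \[F_d(\varepsilon,n)=\sup\left\{\frac{L(T)-L(S(T))}{L(S(T))}: T\in\mathcal{A}_\varepsilon^d(n)\right\}.\]
   Formalization: For n = 3 the bound is claimed only for ε ≤ 2π/3 − δ, with the constant depending on δ > 0, because F_2(ε,3) tends to infinity as ε approaches 2π/3 and is infinite beyond; for n ≥ 4 the full range 0 < ε < π/(n−2) is covered with one constant. *)

theory Defs
  imports "HOL-Analysis.Analysis" "HOL-Library.Landau_Symbols"
begin

section \<open>Finite undirected trees\<close>

text \<open>
  Simple graphs are given by a vertex set and a set of two-element edges. (The notion of tree for
  digraphs in the AFP entry Graph Theory only excludes directed cycles, so it does not express that
  the underlying undirected graph is a tree.)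
\<close>

definition simple_graph :: "'v set \<Rightarrow> 'v set set \<Rightarrow> bool" where
  "simple_graph V E \<longleftrightarrow> finite V \<and> (\<forall>e\<in>E. e \<subseteq> V \<and> card e = 2)"

definition graph_connected :: "'v set \<Rightarrow> 'v set set \<Rightarrow> bool" where
  "graph_connected V E \<longleftrightarrow> V \<noteq> {} \<and> (\<forall>u\<in>V. \<forall>v\<in>V. (u, v) \<in> {(a, b). {a, b} \<in> E}\<^sup>*)"

definition graph_cycle :: "'v set set \<Rightarrow> 'v list \<Rightarrow> bool" where
  "graph_cycle E c \<longleftrightarrow> length c \<ge> 3 \<and> distinct c \<and>
     (\<forall>i<length c. {c ! i, c ! (Suc i mod length c)} \<in> E)"

definition graph_tree :: "'v set \<Rightarrow> 'v set set \<Rightarrow> bool" where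
  "graph_tree V E \<longleftrightarrow> simple_graph V E \<and> graph_connected V E \<and> (\<nexists>c. graph_cycle E c)"

definition degree :: "'v set set \<Rightarrow> 'v \<Rightarrow> nat" where
  "degree E v = card {e\<in>E. v \<in> e}"


section \<open>Steiner topologies and Steiner trees\<close>

text \<open>
  Vertices are natural numbers, the terminals are the vertices \<open>1, \<dots>, n\<close> and all other vertices are
  Steiner points. Up to renaming of vertices, every Steiner topology has this form. A Steiner tree
  is a topology \<open>(V, E)\<close> together with a map \<open>x\<close> placing the vertices in space; the terminal points
  \<open>x 1, \<dots>, x n\<close> need not be distinct. Values of \<open>x\<close> outside \<open>V\<close> are irrelevant.
\<close>

definition steiner_topology :: "nat \<Rightarrow> nat set \<Rightarrow> nat set set \<Rightarrow> bool" where
  "steiner_topology n V E \<longleftrightarrow> graph_tree V E \<and> {1..n} \<subseteq> V \<and>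
     (\<forall>t\<in>{1..n}. degree E t \<le> 3) \<and> (\<forall>s\<in>V - {1..n}. degree E s = 3)"

definition full_topology :: "nat \<Rightarrow> nat set set \<Rightarrow> bool" where
  "full_topology n E \<longleftrightarrow> (\<forall>t\<in>{1..n}. degree E t = 1)"

text \<open>Each edge is listed once, with its smaller end vertex first.\<close>

definition tree_length :: "nat set set \<Rightarrow> (nat \<Rightarrow> 'a::euclidean_space) \<Rightarrow> real" where
  "tree_length E x = (\<Sum>(u, v) | u < v \<and> {u, v} \<in> E. dist (x u) (x v))"

text \<open>The angle in \<open>[0, \<pi>]\<close> between two vectors; meaningful only if both are nonzero.\<close>

definition vec_angle :: "'a::euclidean_space \<Rightarrow> 'a \<Rightarrow> real" where
  "vec_angle u v = arccos (u \<bullet> v / (norm u * norm v))"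

text \<open>
  An edge of length zero spans no angle. So all three edges at a Steiner point of an approximate
  Steiner tree are required to be nondegenerate.
\<close>

definition approx_angles :: "real \<Rightarrow> nat \<Rightarrow> nat set \<Rightarrow> nat set set \<Rightarrow> (nat \<Rightarrow> 'a::euclidean_space) \<Rightarrow> bool" where
  "approx_angles \<epsilon> n V E x \<longleftrightarrow>
     (\<forall>s\<in>V - {1..n}.
        (\<forall>u. {s, u} \<in> E \<longrightarrow> x u \<noteq> x s) \<and>
        (\<forall>u v. {s, u} \<in> E \<and> {s, v} \<in> E \<and> u \<noteq> v \<longrightarrow>
           vec_angle (x u - x s) (x v - x s) \<in> {2 * pi / 3 - \<epsilon> .. 2 * pi / 3 + \<epsilon>}))"

text \<open>The set \<open>\<A>\<^sub>\<epsilon>\<^sup>d(n)\<close>, where \<open>d\<close> is the dimension of the type \<open>'a\<close>.\<close>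

definition approx_steiner_trees ::
    "real \<Rightarrow> nat \<Rightarrow> (nat set \<times> nat set set \<times> (nat \<Rightarrow> 'a::euclidean_space)) set" where
  "approx_steiner_trees \<epsilon> n =
     {(V, E, x). steiner_topology n V E \<and> full_topology n E \<and> approx_angles \<epsilon> n V E x}"

text \<open>
  The positions of \<open>S(T)\<close>: a shortest tree among all trees (degenerate ones included) with the same
  topology and the same terminal points. For some special positions of the terminals there is more
  than one shortest tree, but the length, which is all that is used below, is the same for all of
  them.
\<close>

definition shortest_tree :: "nat \<Rightarrow> nat set set \<Rightarrow> (nat \<Rightarrow> 'a::euclidean_space) \<Rightarrow> (nat \<Rightarrow> 'a)" where
  "shortest_tree n E x = (ARG_MIN (tree_length E) y. \<forall>i\<in>{1..n}. y i = x i)"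

text \<open>
  The number \<open>F\<^sub>d(\<epsilon>, n)\<close> as a supremum in the extended reals, with \<open>d\<close> the dimension of the type
  argument. A tree \<open>T\<close> with \<open>L(S(T)) = 0 < L(T)\<close> contributes the ratio \<open>\<infinity>\<close>.
\<close>

definition rel_error_sup :: "'a::euclidean_space itself \<Rightarrow> real \<Rightarrow> nat \<Rightarrow> ereal" where
  "rel_error_sup _ \<epsilon> n =
     (SUP (V, E, x) \<in> (approx_steiner_trees \<epsilon> n :: (nat set \<times> nat set set \<times> (nat \<Rightarrow> 'a)) set).
        ereal (tree_length E x - tree_length E (shortest_tree n E x))
          / ereal (tree_length E (shortest_tree n E x)))"

end

theory Submission
  imports Defs
begin

text \<open>
  Let \<open>T\<close> be a full \<open>\<epsilon>\<close>-approximate tree with positions \<open>x\<close>, and let \<open>y\<close> be any other positions with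
  the same terminals. Lower bounds for \<open>L(y)\<close> come from duality. If every oriented edge \<open>uv\<close> carries a
  vector \<open>w\<^sub>u\<^sub>v = - w\<^sub>v\<^sub>u\<close> such that the vectors leaving each Steiner point add up to zero, then
  \<open>\<Sum> w\<^sub>u\<^sub>v \<bullet> (y\<^sub>v - y\<^sub>u)\<close> depends on the terminals only (\<open>balanced_flow_pairing\<close>). So it equals
  \<open>\<Sum> w\<^sub>u\<^sub>v \<bullet> (x\<^sub>v - x\<^sub>u)\<close>, and it is at most \<open>(max |w|) L(y)\<close>.

  In the complex plane put \<open>w\<^sub>u\<^sub>v = c\<^sub>u\<^sub>v d\<^sub>u\<^sub>v\<close>, where \<open>d\<^sub>u\<^sub>v\<close> is the direction of the edge in \<open>T\<close> and the
  multiplier \<open>c\<^sub>u\<^sub>v\<close> is a complex number close to 1. Starting with \<open>c = 1\<close> at the terminal \<open>1\<close>, a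
  multiplier is passed on from Steiner point to Steiner point, where balance is restored by factors
  on the two outgoing edges (\<open>multiplier_propagation\<close>). A full topology has \<open>2n - 2\<close> vertices, so
  there are \<open>O(n)\<close> factors on each path. Two choices of factors are used when \<open>\<epsilon>\<close> is small.

  \<^item> Factors of modulus 1 turn the three directions at a Steiner point into directions at exactly
    120 degrees. Each factor is within \<open>O(\<epsilon>)\<close> of 1, so \<open>|c - 1| = O(n\<epsilon>)\<close> with \<open>|c| = 1\<close>, and
    \<open>Re c = 1 - |c - 1|\<^sup>2 / 2\<close> is \<open>1 - O(n\<^sup>2\<epsilon>\<^sup>2)\<close>. This gives the quadratic bound for small \<open>n\<epsilon>\<close>
    (\<open>relative_error_quadratic\<close>).
  \<^item> When \<open>n\<epsilon>\<close> is merely bounded, the phases of such multipliers can exceed a right angle. Positive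
    real factors, which rescale the vectors but keep their directions, exist as well and lie within
    \<open>O(\<epsilon>)\<close> of 1. The multipliers then lie between \<open>exp (- O(n\<epsilon>))\<close> and \<open>exp (O(n\<epsilon>))\<close>, so that the
    relative error is bounded (\<open>relative_error_exponential\<close>). This is enough since \<open>n\<^sup>2\<epsilon>\<^sup>2\<close> is now
    bounded below.

  If \<open>\<epsilon>\<close> exceeds a fixed constant, then \<open>\<epsilon> < \<pi> / (n - 2)\<close> bounds \<open>n\<close>, and all angles stay away from 0:
  for \<open>n \<ge> 4\<close> because \<open>\<epsilon> < \<pi> / 2\<close>, and for \<open>n = 3\<close> because \<open>\<epsilon> \<le> 2\<pi>/3 - \<delta>\<close>. Two edges that span an
  angle bounded below and end near terminals have length comparable to the diameter of the
  terminals, which is at most \<open>L(y)\<close>; working inwards from the leaves, all edges are comparable to it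
  (\<open>tree_length_le_of_angles_bounded_below\<close>).

  A shortest tree exists by compactness (\<open>exists_shortest_tree\<close>). The supremum that defines the
  relative error is nonnegative, since exact trees exist for every \<open>n\<close>
  (\<open>exact_steiner_tree_exists\<close>). The second claim follows from the first by
  \<open>n\<^sup>2\<epsilon>\<^sup>2 = (n\<^sup>2\<epsilon>) \<epsilon>\<close>; there \<open>\<epsilon>\<close> may vanish, and the uniform bound is proved for \<open>\<epsilon> = 0\<close> too.
\<close>

section \<open>Growing a tree\<close>

lemma edge_vertices:
  assumes "simple_graph V E" "{a, b} \<in> E"
  shows "a \<in> V" "b \<in> V" "a \<noteq> b"
proof -
  have "{a,b} \<subseteq> V" "card {a,b} = 2"
    using assms unfolding simple_graph_def by blast+
  then show "a \<in> V" "b \<in> V" "a \<noteq> b" by (auto simp: card_insert_if split: if_splits)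
qed

lemma simple_graph_finite_edges:
  assumes "simple_graph V E"
  shows "finite E"
proof -
  have "E \<subseteq> Pow V" using assms unfolding simple_graph_def by auto
  then show ?thesis using assms finite_subset unfolding simple_graph_def by blast
qed

lemma edge_cases:
  assumes "simple_graph V E" "e \<in> E"
  obtains a b where "e = {a, b}" "a \<noteq> b"
  using assms card_2_iff unfolding simple_graph_def by metis

text \<open>The vertices joined to \<open>v\<close> by an edge.\<close>

definition neighbours :: "'v set set \<Rightarrow> 'v \<Rightarrow> 'v set" where
  "neighbours E v = {u. {v, u} \<in> E}"

lemma card_neighbours:
  assumes "simple_graph V E"
  shows "card (neighbours E v) = degree E v"
proof -
  have "inj_on (\<lambda>u. {v, u}) (neighbours E v)"
    by (auto simp: inj_on_def doubleton_eq_iff)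
  moreover have "(\<lambda>u. {v, u}) ` neighbours E v = {e\<in>E. v \<in> e}"
  proof -
    have "\<exists>u. {v, u} \<in> E \<and> e = {v, u}" if e: "e \<in> E" "v \<in> e" for e
    proof -
      obtain a b where "e = {a, b}" using assms e(1) by (rule edge_cases)
      then show ?thesis using e by (metis empty_iff insertE insert_commute)
    qed
    then show ?thesis by (auto simp: neighbours_def)
  qed
  ultimately show ?thesis unfolding degree_def by (metis card_image)
qed

lemma finite_neighbours:
  assumes "simple_graph V E"
  shows "finite (neighbours E v)"
proof (rule finite_subset)
  show "neighbours E v \<subseteq> V" using edge_vertices[OF assms] by (auto simp: neighbours_def)
  show "finite V" using assms by (simp add: simple_graph_def)
qed

lemma simple_path_exists:
  assumes "(p, q) \<in> {(a, b). {a, b} \<in> E \<and> a \<in> P \<and> b \<in> P}\<^sup>*" and "p \<in> P"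
  shows "\<exists>xs. xs \<noteq> [] \<and> hd xs = p \<and> last xs = q \<and> distinct xs \<and> set xs \<subseteq> P \<and>
           (\<forall>i. Suc i < length xs \<longrightarrow> {xs ! i, xs ! Suc i} \<in> E)"
  using assms(1)
proof (induction rule: rtrancl_induct)
  case base
  show ?case by (rule exI[of _ "[p]"]) (use assms(2) in auto)
next
  case (step y z)
  then obtain xs where xs: "xs \<noteq> []" "hd xs = p" "last xs = y" "distinct xs" "set xs \<subseteq> P"
    "\<And>i. Suc i < length xs \<Longrightarrow> {xs ! i, xs ! Suc i} \<in> E" by blast
  show ?case
  proof (cases "z \<in> set xs")
    case True
    then obtain i where i: "i < length xs" "xs ! i = z" by (meson in_set_conv_nth)
    have ln: "length (take (Suc i) xs) = Suc i" using i by simp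
    then have "last (take (Suc i) xs) = z" using i
      by (metis diff_Suc_1 last_conv_nth length_0_conv lessI nat.simps(3) nth_take)
    moreover have "set (take (Suc i) xs) \<subseteq> P" using xs(5) set_take_subset by fastforce
    ultimately show ?thesis using xs i
      by (intro exI[of _ "take (Suc i) xs"]) auto
  next
    case False
    have "{(xs @ [z]) ! i, (xs @ [z]) ! Suc i} \<in> E" if "Suc i < length (xs @ [z])" for i
    proof (cases "Suc i < length xs")
      case True then show ?thesis using xs(6)[OF True] by (simp add: nth_append)
    next
      case F: False
      then have "i = length xs - 1" "Suc i = length xs" using that by auto
      then show ?thesis using xs(1,3) step(2) by (simp add: nth_append last_conv_nth)
    qed
    then show ?thesis using xs False step(2)
      by (intro exI[of _ "xs @ [z]"]) auto
  qed
qed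

text \<open>
  A vertex outside a connected part of an acyclic graph has at most one neighbour in that part: two
  of them, a path between them and the vertex itself would form a cycle.
\<close>

lemma unique_attachment:
  assumes acyc: "\<nexists>c. graph_cycle E c"
    and conn: "(p, q) \<in> {(a, b). {a, b} \<in> E \<and> a \<in> P \<and> b \<in> P}\<^sup>*"
    and "p \<in> P" "q \<in> P" "s \<notin> P" "{p, s} \<in> E" "{q, s} \<in> E"
  shows "p = q"
proof (rule ccontr)
  assume ne: "p \<noteq> q"
  obtain xs where xs: "xs \<noteq> []" "hd xs = p" "last xs = q" "distinct xs" "set xs \<subseteq> P"
    "\<And>i. Suc i < length xs \<Longrightarrow> {xs ! i, xs ! Suc i} \<in> E"
    using simple_path_exists[OF conn assms(3)] by blast
  have len: "length xs \<ge> 2"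
  proof (rule ccontr)
    assume "\<not> length xs \<ge> 2"
    moreover have "length xs > 0" using xs(1) by simp
    ultimately have "length xs = 1" by linarith
    then obtain z where "xs = [z]" by (auto simp: length_Suc_conv)
    then show False using xs(2,3) ne by simp
  qed
  have "graph_cycle E (s # xs)"
    unfolding graph_cycle_def
  proof (intro conjI allI impI)
    show "3 \<le> length (s # xs)" using len by simp
    show "distinct (s # xs)" using xs assms by auto
    fix i assume i: "i < length (s # xs)"
    consider "i = 0" | "0 < i" "i < length xs" | "i = length xs" using i by fastforce
    then show "{(s # xs) ! i, (s # xs) ! (Suc i mod length (s # xs))} \<in> E"
    proof cases
      case 1
      then show ?thesis using xs(1,2) assms(6) len
        by (cases xs) (auto simp: insert_commute)
    next
      case 2
      then obtain j where "i = Suc j" by (metis gr0_implies_Suc)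
      then show ?thesis using 2 xs(6)[of j] by simp
    next
      case 3
      then show ?thesis using xs(1,3) assms(7) by (simp add: last_conv_nth)
    qed
  qed
  then show False using acyc by blast
qed

text \<open>
  Induction over the growth of a tree from a root: a connected vertex set \<open>P\<close> is extended by a
  vertex \<open>s\<close> that has exactly one neighbour in \<open>P\<close>. Most facts on trees below are proved in this
  way, with the invariant \<open>Q\<close> taking the place of an explicit rooted structure.
\<close>

lemma tree_growth_induct [consumes 2, case_names root grow]:
  assumes tree: "graph_tree V E" and r: "r \<in> V"
    and root: "Q {r}"
    and grow: "\<And>P p s. \<lbrakk>P \<subseteq> V; r \<in> P; Q P; p \<in> P; s \<in> V; s \<notin> P; {p, s} \<in> E;
        \<And>q. q \<in> P \<Longrightarrow> {q, s} \<in> E \<Longrightarrow> q = p\<rbrakk> \<Longrightarrow> Q (insert s P)"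
  shows "Q V"
proof -
  define rel where "rel P = {(a, b). {a, b} \<in> E \<and> a \<in> P \<and> b \<in> P}" for P
  have sg: "simple_graph V E" and acyc: "\<nexists>c. graph_cycle E c"
    and conn: "\<And>u v. u \<in> V \<Longrightarrow> v \<in> V \<Longrightarrow> (u, v) \<in> {(a, b). {a, b} \<in> E}\<^sup>*"
    using tree unfolding graph_tree_def graph_connected_def by blast+
  have finV: "finite V" using sg by (simp add: simple_graph_def)
  have "Q V" if "P \<subseteq> V" "r \<in> P" "Q P" "\<forall>p\<in>P. \<forall>q\<in>P. (p, q) \<in> (rel P)\<^sup>*" for P
    using that
  proof (induction "card (V - P)" arbitrary: P rule: less_induct)
    case less
    show ?case
    proof (cases "P = V")
      case True then show ?thesis using less by simp
    next
      case False
      then obtain v where v: "v \<in> V" "v \<notin> P" using less.prems by blast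
      have "v \<in> P \<or> (\<exists>p\<in>P. \<exists>s. s \<notin> P \<and> {p, s} \<in> E)"
        using conn[OF r v(1)]
        by (induction rule: rtrancl_induct) (use less.prems in auto)
      then obtain p s where ps: "p \<in> P" "s \<notin> P" "{p, s} \<in> E" using v by blast
      then have s: "s \<in> V" using edge_vertices[OF sg] by blast
      have uniq: "q = p" if "q \<in> P" "{q, s} \<in> E" for q
      proof (rule unique_attachment[OF acyc])
        show "(q, p) \<in> {(a, b). {a, b} \<in> E \<and> a \<in> P \<and> b \<in> P}\<^sup>*"
          using less.prems that ps unfolding rel_def by blast
      qed (use that ps in auto)
      have Q: "Q (insert s P)"
        by (rule grow[OF _ _ _ ps(1) s ps(2,3) uniq]) (use less.prems in auto)
      have mono: "(rel P)\<^sup>* \<subseteq> (rel (insert s P))\<^sup>*"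
        by (rule rtrancl_mono) (auto simp: rel_def)
      have e: "(p, s) \<in> rel (insert s P)" "(s, p) \<in> rel (insert s P)"
        using ps by (auto simp: rel_def insert_commute)
      have c1: "(a, s) \<in> (rel (insert s P))\<^sup>*" "(s, a) \<in> (rel (insert s P))\<^sup>*" if "a \<in> P" for a
      proof -
        have "(a, p) \<in> (rel P)\<^sup>*" "(p, a) \<in> (rel P)\<^sup>*" using less.prems(4) that ps(1) by blast+
        then have "(a, p) \<in> (rel (insert s P))\<^sup>*" "(p, a) \<in> (rel (insert s P))\<^sup>*"
          using mono by blast+
        then show "(a, s) \<in> (rel (insert s P))\<^sup>*" "(s, a) \<in> (rel (insert s P))\<^sup>*"
          using e by (auto intro: rtrancl_into_rtrancl converse_rtrancl_into_rtrancl)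
      qed
      have "\<forall>a\<in>insert s P. \<forall>b\<in>insert s P. (a, b) \<in> (rel (insert s P))\<^sup>*"
        using c1 less.prems(4) mono by blast
      moreover have "card (V - insert s P) < card (V - P)"
        using s ps(2) finV by (intro psubset_card_mono) auto
      ultimately show ?thesis using less.hyps[of "insert s P"] Q less.prems s by auto
    qed
  qed
  from this[of "{r}"] show ?thesis using r root by auto
qed

lemma tree_card_edges:
  assumes tree: "graph_tree V E"
  shows "card E + 1 = card V"
proof -
  have sg: "simple_graph V E" using tree by (simp add: graph_tree_def)
  have fin: "finite E" "finite V"
    using sg simple_graph_finite_edges by (auto simp: simple_graph_def)
  obtain r where r: "r \<in> V" using tree unfolding graph_tree_def graph_connected_def by blast
  have "card {e\<in>E. e \<subseteq> V} + 1 = card V"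
    using tree r
  proof (induction rule: tree_growth_induct)
    case root
    have "{e\<in>E. e \<subseteq> {r}} = {}"
      using sg by (auto elim!: edge_cases)
    then show ?case by simp
  next
    case (grow P p s)
    have "e = {p, s}" if e: "e \<in> E" "e \<subseteq> insert s P" "\<not> e \<subseteq> P" for e
    proof -
      obtain a b where ab: "e = {a, b}" "a \<noteq> b" using sg e(1) by (rule edge_cases)
      then consider "a = s" "b \<in> P" | "b = s" "a \<in> P" using e by auto
      then show ?thesis using grow.hyps(7)[of a] grow.hyps(7)[of b] ab e(1) by cases (auto simp: insert_commute)
    qed
    then have "{e\<in>E. e \<subseteq> insert s P} = insert {p, s} {e\<in>E. e \<subseteq> P}"
      using grow.hyps(3,6) by blast
    moreover have "{p, s} \<notin> {e\<in>E. e \<subseteq> P}" using grow.hyps(5) by auto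
    ultimately show ?case using grow.IH grow.hyps(5) fin finite_subset[OF grow.hyps(1)] by simp
  qed
  moreover have "{e\<in>E. e \<subseteq> V} = E" using sg by (auto simp: simple_graph_def)
  ultimately show ?thesis by simp
qed

lemma sum_degrees:
  assumes "simple_graph V E"
  shows "(\<Sum>v\<in>V. degree E v) = 2 * card E"
proof -
  have fin: "finite E" "finite V"
    using assms simple_graph_finite_edges by (auto simp: simple_graph_def)
  have "(\<Sum>v\<in>V. degree E v) = (\<Sum>v\<in>V. \<Sum>e\<in>E. if v \<in> e then 1 else 0)"
    unfolding degree_def using fin by (simp add: sum.If_cases Int_def)
  also have "\<dots> = (\<Sum>e\<in>E. \<Sum>v\<in>V. if v \<in> e then 1 else 0)" by (rule sum.swap)
  also have "\<dots> = (\<Sum>e\<in>E. card e)"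
  proof (rule sum.cong)
    fix e assume "e \<in> E"
    then have "V \<inter> e = e" using assms by (auto simp: simple_graph_def)
    then show "(\<Sum>v\<in>V. if v \<in> e then 1 else 0) = card e"
      using fin by (simp add: sum.If_cases)
  qed simp
  also have "\<dots> = (\<Sum>e\<in>E. 2)" using assms by (intro sum.cong) (auto simp: simple_graph_def)
  finally show ?thesis by simp
qed

lemma full_topology_card_vertices:
  assumes top: "steiner_topology n V E" and full: "full_topology n E"
  shows "card V + 2 = 2 * n"
proof -
  have tree: "graph_tree V E" and sub: "{1..n} \<subseteq> V"
    and st: "\<And>s. s \<in> V - {1..n} \<Longrightarrow> degree E s = 3"
    using top by (auto simp: steiner_topology_def)
  have sg: "simple_graph V E" using tree by (simp add: graph_tree_def)
  have finV: "finite V" using sg by (simp add: simple_graph_def)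
  have "(\<Sum>v\<in>V. degree E v) = (\<Sum>v\<in>V - {1..n}. degree E v) + (\<Sum>v\<in>{1..n}. degree E v)"
    using finV sub by (rule sum.subset_diff[rotated])
  also have "(\<Sum>v\<in>V - {1..n}. degree E v) = 3 * card (V - {1..n})" using st by simp
  also have "(\<Sum>v\<in>{1..n}. degree E v) = n" using full by (simp add: full_topology_def)
  finally have "2 * card E = 3 * card (V - {1..n}) + n" using sum_degrees[OF sg] by simp
  moreover have "card (V - {1..n}) + n = card V"
    using card_Diff_subset[OF _ sub] card_mono[OF finV sub] by simp
  ultimately show ?thesis using tree_card_edges[OF tree] by linarith
qed

lemma steiner_neighbours:
  assumes "simple_graph V E" "degree E s = 3" "{s, p} \<in> E"
  obtains a b where "neighbours E s = {p, a, b}" "p \<noteq> a" "p \<noteq> b" "a \<noteq> b"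
proof -
  have "card (neighbours E s) = 3" using assms card_neighbours by metis
  moreover have p: "p \<in> neighbours E s" using assms(3) by (simp add: neighbours_def)
  ultimately have "card (neighbours E s - {p}) = 2"
    using finite_neighbours[OF assms(1)] by simp
  then obtain a b where ab: "neighbours E s - {p} = {a, b}" "a \<noteq> b" by (auto simp: card_2_iff)
  then have "p \<noteq> a" "p \<noteq> b" by auto
  moreover have "neighbours E s = {p, a, b}" using ab p by blast
  ultimately show thesis using that ab(2) by blast
qed

text \<open>
  A parent function that increases labels up to the root defines a tree. The vertex with the
  smallest label on a cycle would have its parent as both of its neighbours.
\<close>

lemma graph_tree_of_parent_function:
  fixes par :: "nat \<Rightarrow> nat"
  assumes fin: "finite V" and r: "r \<in> V"
    and par: "\<And>v. v \<in> V \<Longrightarrow> v \<noteq> r \<Longrightarrow> v < par v \<and> par v \<in> V"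
  shows "graph_tree V ((\<lambda>v. {v, par v}) ` (V - {r}))" (is "graph_tree V ?E")
proof -
  have simple: "simple_graph V ?E"
    unfolding simple_graph_def
  proof (intro conjI ballI)
    fix e assume "e \<in> ?E"
    then obtain v where v: "v \<in> V" "v \<noteq> r" "e = {v, par v}" by blast
    then show "e \<subseteq> V" "card e = 2" using par[OF v(1,2)] by auto
  qed (rule fin)
  let ?rel = "{(a, b). {a, b} \<in> ?E}"
  have to_root: "(v, r) \<in> ?rel\<^sup>* \<and> (r, v) \<in> ?rel\<^sup>*" if "v \<in> V" for v
    using that
  proof (induction "Max V - v" arbitrary: v rule: less_induct)
    case less
    show ?case
    proof (cases "v = r")
      case False
      then have pv: "v < par v" "par v \<in> V" using par less.prems by auto
      have "par v \<le> Max V" using fin pv(2) by simp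
      then have IH: "(par v, r) \<in> ?rel\<^sup>*" "(r, par v) \<in> ?rel\<^sup>*"
        using less.hyps[of "par v"] pv by (auto simp: diff_less_mono2)
      have "{v, par v} \<in> ?E" using less.prems False by blast
      then have "(v, par v) \<in> ?rel" "(par v, v) \<in> ?rel" by (auto simp: insert_commute)
      then show ?thesis using IH
        by (meson converse_rtrancl_into_rtrancl rtrancl.rtrancl_into_rtrancl)
    qed simp
  qed
  have "graph_connected V ?E"
    unfolding graph_connected_def using r to_root by (meson empty_iff rtrancl_trans)
  moreover have "\<not> graph_cycle ?E c" for c
  proof
    assume "graph_cycle ?E c"
    then have len: "length c \<ge> 3" and dist: "distinct c"
      and edge: "\<And>i. i < length c \<Longrightarrow> {c ! i, c ! (Suc i mod length c)} \<in> ?E"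
      unfolding graph_cycle_def by blast+
    have up: "b = par a" if ab: "{a, b} \<in> ?E" "a \<le> b" for a b
    proof -
      obtain v where v: "v \<in> V" "v \<noteq> r" "{a, b} = {v, par v}" using ab(1) by blast
      then show ?thesis using par[OF v(1,2)] ab(2) by (auto simp: doubleton_eq_iff)
    qed
    have "c \<noteq> []" using len by auto
    then have "Min (set c) \<in> set c" by simp
    then obtain i where i: "i < length c" "c ! i = Min (set c)" by (meson in_set_conv_nth)
    have least: "c ! i \<le> c ! j" if "j < length c" for j using i that by simp
    define m where "m = length c"
    define j where "j = (if Suc i = m then 0 else Suc i)"
    define k where "k = (if i = 0 then m - 1 else i - 1)"
    have m: "m \<ge> 3" "i < m" using len i by (auto simp: m_def)
    have jk: "j < m" "k < m" using m by (auto simp: j_def k_def)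
    have j_next: "Suc i mod m = j" and k_next: "Suc k mod m = i"
      using m by (auto simp: j_def k_def)
    have "j \<noteq> k" using m by (auto simp: j_def k_def)
    moreover have "c ! j = par (c ! i)"
      using up[of "c ! i" "c ! j"] edge[of i] j_next i(1) least jk by (simp add: m_def)
    moreover have "c ! k = par (c ! i)"
      using up[of "c ! i" "c ! k"] edge[of k] k_next least jk by (simp add: m_def insert_commute)
    ultimately show False using dist jk by (metis m_def nth_eq_iff_index_eq)
  qed
  ultimately show ?thesis using simple unfolding graph_tree_def by blast
qed

section \<open>Tree length\<close>

text \<open>
  Every edge in both orientations. Sums over oriented edges can be reorganised vertex by vertex,
  whereas \<^const>\<open>tree_length\<close> lists each edge once.
\<close>

definition arcs :: "'v set set \<Rightarrow> ('v \<times> 'v) set" where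
  "arcs E = {(u, v). {u, v} \<in> E}"

lemma arcs_eq_Sigma:
  assumes "simple_graph V E"
  shows "arcs E = Sigma V (neighbours E)"
  using edge_vertices[OF assms] by (auto simp: arcs_def neighbours_def)

lemma finite_arcs:
  assumes "simple_graph V E"
  shows "finite (arcs E)"
  using assms finite_neighbours[OF assms]
  unfolding arcs_eq_Sigma[OF assms] simple_graph_def by blast

lemma sum_arcs:
  assumes "simple_graph V E"
  shows "(\<Sum>(u, v)\<in>arcs E. f u v) = (\<Sum>u\<in>V. \<Sum>v\<in>neighbours E u. f u v)"
  unfolding arcs_eq_Sigma[OF assms]
  by (rule sum.Sigma[symmetric])
    (use assms finite_neighbours[OF assms] in \<open>auto simp: simple_graph_def\<close>)

lemma sum_arcs_swap: "(\<Sum>(u, v)\<in>arcs E. f u v) = (\<Sum>(u, v)\<in>arcs E. f v u)"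
  by (rule sum.reindex_bij_witness[where i = prod.swap and j = prod.swap])
    (auto simp: arcs_def insert_commute)

lemma sum_arcs_symmetric:
  fixes f :: "nat \<Rightarrow> nat \<Rightarrow> real"
  assumes sg: "simple_graph V E" and sym: "\<And>u v. f u v = f v u"
  shows "(\<Sum>(u, v)\<in>arcs E. f u v) = 2 * (\<Sum>(u, v) | u < v \<and> {u, v} \<in> E. f u v)"
proof -
  let ?A = "{(u, v). u < v \<and> {u, v} \<in> E}" and ?B = "{(u, v). v < u \<and> {u, v} \<in> E}"
  have un: "arcs E = ?A \<union> ?B"
    using edge_vertices(3)[OF sg] by (fastforce simp: arcs_def neq_iff)
  have fin: "finite ?A" "finite ?B" using finite_arcs[OF sg] unfolding un by auto
  have "(\<Sum>(u, v)\<in>?B. f u v) = (\<Sum>(u, v)\<in>?A. f u v)"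
    by (rule sum.reindex_bij_witness[where i = prod.swap and j = prod.swap])
      (auto simp: insert_commute sym)
  moreover have "(\<Sum>(u, v)\<in>arcs E. f u v) = (\<Sum>(u, v)\<in>?A. f u v) + (\<Sum>(u, v)\<in>?B. f u v)"
    unfolding un by (rule sum.union_disjoint) (use fin in auto)
  ultimately show ?thesis by (simp add: case_prod_unfold)
qed

lemma tree_length_nonneg: "0 \<le> tree_length E x"
  unfolding tree_length_def by (rule sum_nonneg) auto

lemma dist_le_tree_length:
  assumes tree: "graph_tree V E" and "r \<in> V" "v \<in> V"
  shows "dist (y r) (y v) \<le> tree_length E y"
proof -
  have sg: "simple_graph V E" using tree by (simp add: graph_tree_def)
  define pairs where "pairs P = {(u, v). u < v \<and> {u, v} \<in> E \<and> u \<in> P \<and> v \<in> P}" for P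
  have fin: "finite (pairs P)" for P
    by (rule finite_subset[OF _ finite_arcs[OF sg]]) (auto simp: pairs_def arcs_def)
  have "\<forall>p\<in>V. dist (y r) (y p) \<le> (\<Sum>(u, v)\<in>pairs V. dist (y u) (y v))"
    using tree assms(2)
  proof (induction rule: tree_growth_induct)
    case root
    have "0 \<le> (\<Sum>(u, v)\<in>pairs {r}. dist (y u) (y v))" by (rule sum_nonneg) auto
    then show ?case by simp
  next
    case (grow P p s)
    let ?e = "(min p s, max p s)"
    have ps: "p \<noteq> s" using grow.hyps(3,5) by blast
    have sub: "insert ?e (pairs P) \<subseteq> pairs (insert s P)"
      using grow.hyps(3,6) ps by (auto simp: pairs_def min_def max_def insert_commute)
    have "?e \<notin> pairs P" using grow.hyps(5) by (auto simp: pairs_def min_def max_def)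
    then have "dist (y p) (y s) + (\<Sum>(u, v)\<in>pairs P. dist (y u) (y v)) =
        (\<Sum>(u, v)\<in>insert ?e (pairs P). dist (y u) (y v))"
      using fin by (simp add: min_def max_def dist_commute)
    also have "\<dots> \<le> (\<Sum>(u, v)\<in>pairs (insert s P). dist (y u) (y v))"
      by (rule sum_mono2[OF fin sub]) auto
    finally have le: "dist (y p) (y s) + (\<Sum>(u, v)\<in>pairs P. dist (y u) (y v)) \<le>
      (\<Sum>(u, v)\<in>pairs (insert s P). dist (y u) (y v))" .
    have "dist (y r) (y q) \<le> (\<Sum>(u, v)\<in>pairs P. dist (y u) (y v))" if "q \<in> P" for q
      using grow.IH that by blast
    moreover have "dist (y r) (y s) \<le> dist (y r) (y p) + dist (y p) (y s)"
      by (rule dist_triangle)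
    ultimately have "dist (y r) (y q) \<le> (\<Sum>(u, v)\<in>pairs (insert s P). dist (y u) (y v))"
      if "q \<in> insert s P" for q
      using that le grow.hyps(3) zero_le_dist[of "y p" "y s"] by (smt (verit) insertE)
    then show ?case by blast
  qed
  moreover have "pairs V = {(u, v). u < v \<and> {u, v} \<in> E}"
    using edge_vertices[OF sg] by (auto simp: pairs_def)
  ultimately show ?thesis using assms(3) by (auto simp: tree_length_def)
qed

text \<open>
  Duality: a flow that is balanced at all vertices outside \<open>A\<close> has the same pairing with the edge
  vectors of any two placements that agree on \<open>A\<close>. The difference of the two sides is
  the flow paired with a displacement that vanishes on \<open>A\<close>, and summation by parts turns it into a sum
  of net outflows over the other vertices.
\<close>

lemma balanced_flow_pairing:
  fixes w :: "nat \<Rightarrow> nat \<Rightarrow> 'a::euclidean_space"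
  assumes sg: "simple_graph V E"
    and anti: "\<And>u v. w v u = - w u v"
    and bal: "\<And>s. s \<in> V - A \<Longrightarrow> (\<Sum>v\<in>neighbours E s. w s v) = 0"
    and eq: "\<And>t. t \<in> A \<Longrightarrow> x t = y t"
  shows "(\<Sum>(u, v) | u < v \<and> {u, v} \<in> E. w u v \<bullet> (x v - x u)) =
         (\<Sum>(u, v) | u < v \<and> {u, v} \<in> E. w u v \<bullet> (y v - y u))"
proof -
  define z where "z v = x v - y v" for v
  have zero: "(\<Sum>(u, v)\<in>arcs E. w u v \<bullet> z u) = 0"
  proof -
    have "(\<Sum>(u, v)\<in>arcs E. w u v \<bullet> z u) = (\<Sum>u\<in>V. (\<Sum>v\<in>neighbours E u. w u v) \<bullet> z u)"
      by (simp add: sum_arcs[OF sg] inner_sum_left)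
    also have "\<dots> = 0"
      by (rule sum.neutral) (use bal eq in \<open>force simp: z_def\<close>)
    finally show ?thesis .
  qed
  have "(\<Sum>(u, v)\<in>arcs E. w u v \<bullet> z v) = (\<Sum>(u, v)\<in>arcs E. w v u \<bullet> z u)"
    by (rule sum_arcs_swap)
  also have "\<dots> = - (\<Sum>(u, v)\<in>arcs E. w u v \<bullet> z u)"
  proof -
    have "w v u \<bullet> z u = - (w u v \<bullet> z u)" for u v using anti[of u v] by simp
    then show ?thesis unfolding sum_negf[symmetric] by (intro sum.cong) auto
  qed
  finally have zero': "(\<Sum>(u, v)\<in>arcs E. w u v \<bullet> z v) = 0" using zero by simp
  have sym: "w u v \<bullet> (q v - q u) = w v u \<bullet> (q u - q v)" for u v and q :: "nat \<Rightarrow> 'a"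
    using anti[of u v] by (simp add: inner_diff_right)
  have "(\<Sum>(u, v)\<in>arcs E. w u v \<bullet> (x v - x u)) - (\<Sum>(u, v)\<in>arcs E. w u v \<bullet> (y v - y u)) =
        (\<Sum>(u, v)\<in>arcs E. w u v \<bullet> z v) - (\<Sum>(u, v)\<in>arcs E. w u v \<bullet> z u)"
    unfolding sum_subtractf[symmetric]
    by (rule sum.cong) (auto simp: z_def inner_diff_right)
  then have "(\<Sum>(u, v)\<in>arcs E. w u v \<bullet> (x v - x u)) = (\<Sum>(u, v)\<in>arcs E. w u v \<bullet> (y v - y u))"
    using zero zero' by simp
  moreover have "(\<Sum>(u, v)\<in>arcs E. w u v \<bullet> (q v - q u)) =
      2 * (\<Sum>(u, v) | u < v \<and> {u, v} \<in> E. w u v \<bullet> (q v - q u))" for q :: "nat \<Rightarrow> 'a"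
    by (rule sum_arcs_symmetric[OF sg sym])
  ultimately show ?thesis by simp
qed

lemma tree_length_lower_bound_by_flow:
  fixes w :: "nat \<Rightarrow> nat \<Rightarrow> 'a::euclidean_space"
  assumes sg: "simple_graph V E"
    and anti: "\<And>u v. w v u = - w u v"
    and bal: "\<And>s. s \<in> V - A \<Longrightarrow> (\<Sum>v\<in>neighbours E s. w s v) = 0"
    and eq: "\<And>t. t \<in> A \<Longrightarrow> x t = y t"
    and upper: "\<And>u v. {u, v} \<in> E \<Longrightarrow> norm (w u v) \<le> M"
    and aligned: "\<And>u v. {u, v} \<in> E \<Longrightarrow> \<rho> * dist (x u) (x v) \<le> w u v \<bullet> (x v - x u)"
  shows "\<rho> * tree_length E x \<le> M * tree_length E y"
proof -
  have "\<rho> * tree_length E x \<le> (\<Sum>(u, v) | u < v \<and> {u, v} \<in> E. w u v \<bullet> (x v - x u))"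
    unfolding tree_length_def sum_distrib_left
    by (rule sum_mono) (use aligned in auto)
  also have "\<dots> = (\<Sum>(u, v) | u < v \<and> {u, v} \<in> E. w u v \<bullet> (y v - y u))"
    by (rule balanced_flow_pairing[OF sg anti bal eq])
  also have "\<dots> \<le> M * tree_length E y"
    unfolding tree_length_def sum_distrib_left
  proof (rule sum_mono, clarify)
    fix u v assume "{u, v} \<in> E"
    have "w u v \<bullet> (y v - y u) \<le> norm (w u v) * norm (y v - y u)" by (rule norm_cauchy_schwarz)
    also have "\<dots> \<le> M * norm (y v - y u)"
      using upper[OF \<open>{u, v} \<in> E\<close>] by (intro mult_right_mono) auto
    finally show "w u v \<bullet> (y v - y u) \<le> M * dist (y u) (y v)"
      by (simp add: dist_norm norm_minus_commute)
  qed
  finally show ?thesis .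
qed

section \<open>Angles and triples of directions\<close>

lemma abs_cos_diff_le: "\<bar>cos a - cos b\<bar> \<le> \<bar>a - b :: real\<bar>"
proof -
  have "\<bar>cos a - cos b\<bar> = 2 * \<bar>sin ((a + b) / 2)\<bar> * \<bar>sin ((b - a) / 2)\<bar>"
    by (simp add: cos_diff_cos abs_mult)
  also have "\<dots> \<le> 2 * 1 * \<bar>(b - a) / 2\<bar>"
    by (intro mult_mono abs_sin_x_le_abs_x) auto
  finally show ?thesis by simp
qed

lemma abs_inner_div_norms_le_one: "\<bar>u \<bullet> v / (norm u * norm v)\<bar> \<le> 1"
proof -
  have "\<bar>u \<bullet> v\<bar> \<le> norm u * norm v" by (rule Cauchy_Schwarz_ineq2)
  then show ?thesis by (cases "u = 0 \<or> v = 0") (auto simp: divide_simps abs_mult)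
qed

lemma cos_vec_angle:
  "cos (vec_angle u v) = sgn u \<bullet> sgn v"
proof -
  have "cos (vec_angle u v) = u \<bullet> v / (norm u * norm v)"
    unfolding vec_angle_def by (rule cos_arccos_abs[OF abs_inner_div_norms_le_one])
  then show ?thesis by (simp add: sgn_div_norm divide_inverse mult_ac)
qed

lemma vec_angle_le_pi: "vec_angle u v \<le> pi"
proof -
  have "- 1 \<le> u \<bullet> v / (norm u * norm v) \<and> u \<bullet> v / (norm u * norm v) \<le> 1"
    using abs_inner_div_norms_le_one[of u v] unfolding abs_le_iff by linarith
  then show ?thesis unfolding vec_angle_def by (intro arccos_ubound) auto
qed

lemma inner_sgn_near_half:
  assumes "vec_angle u v \<in> {2 * pi / 3 - \<epsilon> .. 2 * pi / 3 + \<epsilon>}"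
  shows "\<bar>sgn u \<bullet> sgn v + 1 / 2\<bar> \<le> \<epsilon>"
proof -
  have "\<bar>cos (vec_angle u v) - cos (2 * pi / 3)\<bar> \<le> \<bar>vec_angle u v - 2 * pi / 3\<bar>"
    by (rule abs_cos_diff_le)
  also have "\<dots> \<le> \<epsilon>" using assms by auto
  finally show ?thesis by (simp add: cos_vec_angle cos_120)
qed

lemma norm_mult_sin_le_of_angle:
  assumes "0 \<le> \<eta>" "\<eta> \<le> pi / 2" "\<eta> \<le> vec_angle u v"
  shows "norm u * sin \<eta> \<le> norm (u - v)"
proof (rule power2_le_imp_le)
  have "sgn u \<bullet> sgn v \<le> cos \<eta>"
    using assms cos_monotone_0_pi_le[of \<eta> "vec_angle u v"] vec_angle_le_pi[of u v]
    by (simp add: cos_vec_angle)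
  then have "(norm u * norm v) * (sgn u \<bullet> sgn v) \<le> (norm u * norm v) * cos \<eta>"
    by (intro mult_left_mono) auto
  moreover have "(norm u * norm v) * (sgn u \<bullet> sgn v) = u \<bullet> v"
    by (cases "u = 0 \<or> v = 0") (auto simp: sgn_div_norm field_simps)
  ultimately have uv: "u \<bullet> v \<le> (norm u * norm v) * cos \<eta>" by simp
  have "(norm (u - v))\<^sup>2 = (norm u)\<^sup>2 + (norm v)\<^sup>2 - 2 * (u \<bullet> v)"
    by (simp add: power2_norm_eq_inner inner_diff_left inner_diff_right inner_commute)
  also have "\<dots> \<ge> (norm u)\<^sup>2 + (norm v)\<^sup>2 - 2 * ((norm u * norm v) * cos \<eta>)"
    using uv by simp
  moreover have "(norm u)\<^sup>2 + (norm v)\<^sup>2 - 2 * ((norm u * norm v) * cos \<eta>) =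
      (norm v - norm u * cos \<eta>)\<^sup>2 + (norm u)\<^sup>2 * (1 - (cos \<eta>)\<^sup>2)"
    by (simp add: power2_eq_square algebra_simps)
  moreover have "1 - (cos \<eta>)\<^sup>2 = (sin \<eta>)\<^sup>2" by (simp add: sin_squared_eq)
  moreover have "(norm v - norm u * cos \<eta>)\<^sup>2 \<ge> 0" by simp
  ultimately show "(norm u * sin \<eta>)\<^sup>2 \<le> (norm (u - v))\<^sup>2"
    unfolding power_mult_distrib by (smt (verit))
qed simp

text \<open>
  Three unit vectors with pairwise inner products close to \<open>-1/2\<close>. Relative to \<open>\<alpha>\<close>, the other two are
  close to the two primitive cube roots of unity, one to each; the sign \<open>\<sigma>\<close> records which vector is
  close to which root. They cannot both be close to the same root, as their mutual inner product would be
  positive.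
\<close>

lemma near_triple_coordinates:
  fixes \<alpha> \<beta> \<gamma> :: complex
  assumes unit: "norm \<alpha> = 1" "norm \<beta> = 1" "norm \<gamma> = 1" and eps: "\<epsilon> \<le> 1 / 6"
    and near: "\<bar>\<alpha> \<bullet> \<beta> + 1 / 2\<bar> \<le> \<epsilon>" "\<bar>\<alpha> \<bullet> \<gamma> + 1 / 2\<bar> \<le> \<epsilon>" "\<bar>\<beta> \<bullet> \<gamma> + 1 / 2\<bar> \<le> \<epsilon>"
  obtains b g \<sigma> where "\<beta> = \<alpha> * b" "\<gamma> = \<alpha> * g" "norm b = 1" "norm g = 1" "\<sigma> = 1 \<or> \<sigma> = -1"
    "\<bar>Re b + 1 / 2\<bar> \<le> \<epsilon>" "\<bar>\<sigma> * Im b - sqrt 3 / 2\<bar> \<le> 2 * \<epsilon>"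
    "\<bar>Re g + 1 / 2\<bar> \<le> \<epsilon>" "\<bar>\<sigma> * Im g + sqrt 3 / 2\<bar> \<le> 2 * \<epsilon>"
proof -
  define b where "b = \<beta> * cnj \<alpha>"
  define g where "g = \<gamma> * cnj \<alpha>"
  have aa: "\<alpha> * cnj \<alpha> = 1" using unit(1) by (simp add: complex_norm_square[symmetric])
  have eqs: "\<beta> = \<alpha> * b" "\<gamma> = \<alpha> * g" using aa by (simp_all add: b_def g_def mult.left_commute)
  have nb: "norm b = 1" and ng: "norm g = 1" using unit by (simp_all add: b_def g_def norm_mult)
  have Reb: "Re b = \<alpha> \<bullet> \<beta>" and Reg: "Re g = \<alpha> \<bullet> \<gamma>"
    by (simp_all add: b_def g_def inner_complex_def algebra_simps)
  have "b \<bullet> g = \<beta> \<bullet> \<gamma> * (norm \<alpha>)\<^sup>2"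
    unfolding cmod_power2 by (simp add: b_def g_def inner_complex_def algebra_simps power2_eq_square)
  then have bg: "b \<bullet> g = \<beta> \<bullet> \<gamma>" using unit by simp
  have im: "\<bar>\<bar>Im z\<bar> - sqrt 3 / 2\<bar> \<le> 2 * \<epsilon>" if "norm z = 1" "\<bar>Re z + 1 / 2\<bar> \<le> \<epsilon>" for z
  proof -
    have s: "sqrt 3 \<ge> (3 / 2 :: real)" by (rule real_le_rsqrt) (simp add: power2_eq_square)
    have "(\<bar>Im z\<bar> - sqrt 3 / 2) * (\<bar>Im z\<bar> + sqrt 3 / 2) = (Im z)\<^sup>2 - 3 / 4"
      by (simp add: algebra_simps power2_eq_square)
    also have "(Im z)\<^sup>2 = 1 - (Re z)\<^sup>2" using that(1) cmod_power2[of z] by simp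
    also have "1 - (Re z)\<^sup>2 - 3 / 4 = (1 / 2 - Re z) * (Re z + 1 / 2)"
      by (simp add: algebra_simps power2_eq_square)
    finally have "\<bar>\<bar>Im z\<bar> - sqrt 3 / 2\<bar> * (\<bar>Im z\<bar> + sqrt 3 / 2) = \<bar>1 / 2 - Re z\<bar> * \<bar>Re z + 1 / 2\<bar>"
      by (metis abs_mult abs_of_nonneg abs_ge_zero add_nonneg_nonneg divide_nonneg_nonneg
          real_sqrt_ge_zero zero_le_numeral)
    also have "\<dots> \<le> (3 / 2) * \<epsilon>"
      by (rule mult_mono) (use that(2) eps in auto)
    finally have *: "\<bar>\<bar>Im z\<bar> - sqrt 3 / 2\<bar> * (\<bar>Im z\<bar> + sqrt 3 / 2) \<le> (3 / 2) * \<epsilon>" .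
    have "\<bar>\<bar>Im z\<bar> - sqrt 3 / 2\<bar> * (3 / 4) \<le> \<bar>\<bar>Im z\<bar> - sqrt 3 / 2\<bar> * (\<bar>Im z\<bar> + sqrt 3 / 2)"
      by (rule mult_left_mono) (use s in auto)
    then show ?thesis using * by linarith
  qed
  have rb: "\<bar>Re b + 1 / 2\<bar> \<le> \<epsilon>" and rg: "\<bar>Re g + 1 / 2\<bar> \<le> \<epsilon>" using near Reb Reg by auto
  have neg: "Im b * Im g < 0"
  proof -
    have "Re b \<le> 0" "Re g \<le> 0" using rb rg eps by linarith+
    then have "Re b * Re g \<ge> 0" by (rule mult_nonpos_nonpos)
    moreover have "Re b * Re g + Im b * Im g \<le> - 1 / 2 + \<epsilon>"
      using near(3) bg by (simp add: inner_complex_def)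
    ultimately show ?thesis using eps by linarith
  qed
  define \<sigma> where "\<sigma> = sgn (Im b)"
  have \<sigma>: "\<sigma> * Im b = \<bar>Im b\<bar>" "\<sigma> * Im g = - \<bar>Im g\<bar>" "\<sigma> = 1 \<or> \<sigma> = -1"
    using neg by (auto simp: \<sigma>_def sgn_if mult_less_0_iff)
  have "\<bar>\<sigma> * Im b - sqrt 3 / 2\<bar> \<le> 2 * \<epsilon>" unfolding \<sigma>(1) by (rule im[OF nb rb])
  moreover have "\<bar>\<sigma> * Im g + sqrt 3 / 2\<bar> \<le> 2 * \<epsilon>"
    unfolding \<sigma>(2) using im[OF ng rg] by linarith
  ultimately show thesis by (rule that[OF eqs nb ng \<sigma>(3) rb _ rg])
qed

text \<open>Rotating \<open>\<beta>\<close> and \<open>\<gamma>\<close> to exact angles of 120 degrees with \<open>\<alpha>\<close> restores balance.\<close>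

lemma unimodular_correction:
  fixes \<alpha> \<beta> \<gamma> :: complex
  assumes unit: "norm \<alpha> = 1" "norm \<beta> = 1" "norm \<gamma> = 1" and eps: "\<epsilon> \<le> 1 / 6"
    and near: "\<bar>\<alpha> \<bullet> \<beta> + 1 / 2\<bar> \<le> \<epsilon>" "\<bar>\<alpha> \<bullet> \<gamma> + 1 / 2\<bar> \<le> \<epsilon>" "\<bar>\<beta> \<bullet> \<gamma> + 1 / 2\<bar> \<le> \<epsilon>"
  shows "\<exists>\<mu> \<nu>. \<alpha> + \<mu> * \<beta> + \<nu> * \<gamma> = 0 \<and> norm \<mu> = 1 \<and> norm \<nu> = 1 \<and>
           norm (\<mu> - 1) \<le> 3 * \<epsilon> \<and> norm (\<nu> - 1) \<le> 3 * \<epsilon>"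
proof -
  obtain b g \<sigma> where bg: "\<beta> = \<alpha> * b" "\<gamma> = \<alpha> * g" "norm b = 1" "norm g = 1" "\<sigma> = 1 \<or> \<sigma> = -1"
    "\<bar>Re b + 1 / 2\<bar> \<le> \<epsilon>" "\<bar>\<sigma> * Im b - sqrt 3 / 2\<bar> \<le> 2 * \<epsilon>"
    "\<bar>Re g + 1 / 2\<bar> \<le> \<epsilon>" "\<bar>\<sigma> * Im g + sqrt 3 / 2\<bar> \<le> 2 * \<epsilon>"
    using near_triple_coordinates[OF assms] by blast
  define \<omega> where "\<omega> = Complex (- 1 / 2) (\<sigma> * sqrt 3 / 2)"
  have n\<omega>: "norm \<omega> = 1"
    using bg(5) by (auto simp: \<omega>_def cmod_def power2_eq_square)
  have unit_mult: "z * cnj z = 1" if "norm z = 1" for z :: complex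
    using that by (simp add: complex_norm_square[symmetric])
  have dist_le: "norm (w * cnj z - 1) \<le> 3 * \<epsilon>"
    if "norm z = 1" "\<bar>Re w - Re z\<bar> \<le> \<epsilon>" "\<bar>Im w - Im z\<bar> \<le> 2 * \<epsilon>" for w z :: complex
  proof -
    have "w * cnj z - 1 = (w - z) * cnj z" using unit_mult[OF that(1)] by (simp add: algebra_simps)
    then have "norm (w * cnj z - 1) = norm (w - z)" using that(1) by (simp add: norm_mult)
    also have "\<dots> \<le> \<bar>Re (w - z)\<bar> + \<bar>Im (w - z)\<bar>" by (rule cmod_le)
    also have "\<dots> \<le> 3 * \<epsilon>" using that by simp
    finally show ?thesis .
  qed
  have "norm (\<omega> * cnj b - 1) \<le> 3 * \<epsilon>" "norm (cnj \<omega> * cnj g - 1) \<le> 3 * \<epsilon>"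
    by (rule dist_le; use bg in \<open>auto simp: \<omega>_def abs_if split: if_splits\<close>)+
  moreover have "\<alpha> + (\<omega> * cnj b) * \<beta> + (cnj \<omega> * cnj g) * \<gamma> = 0"
  proof -
    have "(\<omega> * cnj b) * \<beta> = \<alpha> * \<omega> * (b * cnj b)" "(cnj \<omega> * cnj g) * \<gamma> = \<alpha> * cnj \<omega> * (g * cnj g)"
      using bg by (simp_all add: algebra_simps)
    then have "\<alpha> + (\<omega> * cnj b) * \<beta> + (cnj \<omega> * cnj g) * \<gamma> = \<alpha> * (1 + \<omega> + cnj \<omega>)"
      using unit_mult bg by (simp add: algebra_simps)
    moreover have "1 + \<omega> + cnj \<omega> = 0" by (simp add: \<omega>_def complex_eq_iff)
    ultimately show ?thesis by simp
  qed
  ultimately show ?thesis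
    using n\<omega> bg by (intro exI[of _ "\<omega> * cnj b"] exI[of _ "cnj \<omega> * cnj g"]) (auto simp: norm_mult)
qed

text \<open>
  Balance can also be restored by rescaling \<open>\<beta>\<close> and \<open>\<gamma>\<close>, since three vectors that are nearly 120
  degrees apart are positively dependent. The coefficients below solve the two real linear equations
  by Cramer's rule.
\<close>

lemma positive_correction:
  fixes \<alpha> \<beta> \<gamma> :: complex
  assumes unit: "norm \<alpha> = 1" "norm \<beta> = 1" "norm \<gamma> = 1" and eps: "\<epsilon> \<le> 1 / 100"
    and near: "\<bar>\<alpha> \<bullet> \<beta> + 1 / 2\<bar> \<le> \<epsilon>" "\<bar>\<alpha> \<bullet> \<gamma> + 1 / 2\<bar> \<le> \<epsilon>" "\<bar>\<beta> \<bullet> \<gamma> + 1 / 2\<bar> \<le> \<epsilon>"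
  shows "\<exists>l m :: real. \<alpha> + of_real l * \<beta> + of_real m * \<gamma> = 0 \<and>
           \<bar>l - 1\<bar> \<le> 5 * \<epsilon> \<and> \<bar>m - 1\<bar> \<le> 5 * \<epsilon>"
proof -
  have eps6: "\<epsilon> \<le> 1 / 6" using eps by simp
  obtain b g \<sigma> where bg: "\<beta> = \<alpha> * b" "\<gamma> = \<alpha> * g" "\<sigma> = 1 \<or> \<sigma> = -1"
    "\<bar>Re b + 1 / 2\<bar> \<le> \<epsilon>" "\<bar>\<sigma> * Im b - sqrt 3 / 2\<bar> \<le> 2 * \<epsilon>"
    "\<bar>Re g + 1 / 2\<bar> \<le> \<epsilon>" "\<bar>\<sigma> * Im g + sqrt 3 / 2\<bar> \<le> 2 * \<epsilon>"
    using near_triple_coordinates[OF unit eps6 near] by blast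
  define p where "p = \<sigma> * Im b"
  define q where "q = - (\<sigma> * Im g)"
  define D where "D = - (Re b * q + Re g * p)"
  have s: "sqrt 3 \<ge> (172 / 100 :: real)" "sqrt 3 \<le> (174 / 100 :: real)"
    by (rule real_le_rsqrt real_le_lsqrt; simp add: power2_eq_square)+
  have pq: "\<bar>p - sqrt 3 / 2\<bar> \<le> 2 * \<epsilon>" "\<bar>q - sqrt 3 / 2\<bar> \<le> 2 * \<epsilon>"
    using bg unfolding p_def q_def by linarith+
  have range: "p \<ge> 84 / 100" "q \<ge> 84 / 100" "p \<le> 89 / 100" "q \<le> 89 / 100"
    using pq s eps by linarith+
  have e0: "\<epsilon> \<ge> 0" using bg(4) by linarith
  have D: "D \<ge> 82 / 100"
  proof -
    have "(49 / 100) * (84 / 100) \<le> (- Re b) * q" "(49 / 100) * (84 / 100) \<le> (- Re g) * p"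
      by (rule mult_mono; use bg range eps in linarith)+
    then show ?thesis unfolding D_def by linarith
  qed
  have prods: "\<bar>(Re b + 1 / 2) * q\<bar> \<le> \<epsilon>" "\<bar>(Re g + 1 / 2) * p\<bar> \<le> \<epsilon>"
    unfolding abs_mult
    using mult_mono[of "\<bar>Re b + 1 / 2\<bar>" \<epsilon> "\<bar>q\<bar>" 1] mult_mono[of "\<bar>Re g + 1 / 2\<bar>" \<epsilon> "\<bar>p\<bar>" 1]
      bg range e0 by auto
  have qD: "\<bar>q - D\<bar> \<le> 4 * \<epsilon>" and pD: "\<bar>p - D\<bar> \<le> 4 * \<epsilon>"
  proof -
    define h k where "h = (Re b + 1 / 2) * q" and "k = (Re g + 1 / 2) * p"
    have diffs: "q - D = (q - p) / 2 + h + k" "p - D = (p - q) / 2 + h + k"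
      unfolding D_def h_def k_def by (simp_all add: field_simps)
    have hk: "\<bar>h\<bar> \<le> \<epsilon>" "\<bar>k\<bar> \<le> \<epsilon>" unfolding h_def k_def by (rule prods)+
    have qp: "\<bar>q - p\<bar> \<le> 4 * \<epsilon>" "\<bar>p - q\<bar> \<le> 4 * \<epsilon>" using pq by linarith+
    show "\<bar>q - D\<bar> \<le> 4 * \<epsilon>" using diffs(1) hk qp by argo
    show "\<bar>p - D\<bar> \<le> 4 * \<epsilon>" using diffs(2) hk qp by argo
  qed
  have quot: "\<bar>a / D - 1\<bar> \<le> 5 * \<epsilon>" if "\<bar>a - D\<bar> \<le> 4 * \<epsilon>" for a
  proof -
    have "\<bar>a / D - 1\<bar> = \<bar>a - D\<bar> / D" using D by (simp add: field_simps)
    also have "\<dots> \<le> 5 * \<epsilon>"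
      using that D mult_left_mono[OF D, of "5 * \<epsilon>"] e0 by (simp add: divide_le_eq)
    finally show ?thesis .
  qed
  have "1 + of_real (q / D) * b + of_real (p / D) * g = 0"
  proof (rule complex_eqI)
    show "Re (1 + of_real (q / D) * b + of_real (p / D) * g) = Re 0"
      using D by (simp add: field_simps) (simp add: D_def algebra_simps)
    show "Im (1 + of_real (q / D) * b + of_real (p / D) * g) = Im 0"
      using D bg(3) by (auto simp: p_def q_def field_simps)
  qed
  then have "\<alpha> * (1 + of_real (q / D) * b + of_real (p / D) * g) = 0" by simp
  then have "\<alpha> + of_real (q / D) * \<beta> + of_real (p / D) * \<gamma> = 0"
    unfolding bg(1,2) by (simp add: algebra_simps)
  then show ?thesis using quot[OF qD] quot[OF pD] by blast
qed

section \<open>Propagating multipliers through a tree\<close>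

text \<open>
  Propagation of multipliers from a root through a tree whose vertices outside \<open>S\<close> are leaves. The
  vectors \<open>d s v\<close> are given, and each edge receives a multiplier that makes the vertices in \<open>S\<close> balanced.
  The predicate \<open>R k c\<close> says that \<open>c\<close> is admissible after at most \<open>k\<close> corrections; the assumption
  on branches provides correction factors on the two other edges at \<open>s\<close>, whichever edge \<open>s p\<close> is
  given, that lead from admissible multipliers to admissible ones.
\<close>

lemma multiplier_propagation:
  fixes d :: "'v \<Rightarrow> 'v \<Rightarrow> complex"
  assumes tree: "graph_tree V E" and r: "r \<in> V" "r \<notin> S"
    and leaf: "\<And>v. v \<in> V \<Longrightarrow> v \<notin> S \<Longrightarrow> degree E v = 1"
    and R0: "R 0 1" and R_Suc: "\<And>k c. R k c \<Longrightarrow> R (Suc k) c"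
    and branch: "\<And>s p. s \<in> S \<Longrightarrow> {s, p} \<in> E \<Longrightarrow>
       \<exists>a b \<mu> \<nu>. neighbours E s = {p, a, b} \<and> p \<noteq> a \<and> p \<noteq> b \<and> a \<noteq> b \<and>
         d s p + \<mu> * d s a + \<nu> * d s b = 0 \<and>
         (\<forall>k c. R k c \<longrightarrow> R (Suc k) (c * \<mu>) \<and> R (Suc k) (c * \<nu>))"
  shows "\<exists>c. (\<forall>e\<in>E. R (card V) (c e)) \<and>
             (\<forall>s\<in>S \<inter> V. (\<Sum>v\<in>neighbours E s. c {s, v} * d s v) = 0)"
proof -
  have sg: "simple_graph V E" using tree by (simp add: graph_tree_def)
  have finV: "finite V" using sg by (simp add: simple_graph_def)
  have "\<exists>c. (\<forall>e\<in>E. e \<inter> V \<noteq> {} \<longrightarrow> R (card V) (c e)) \<and>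
             (\<forall>s\<in>S \<inter> V. (\<Sum>v\<in>neighbours E s. c {s, v} * d s v) = 0)"
    using tree r(1)
  proof (induction rule: tree_growth_induct)
    case root
    then show ?case using r(2) R_Suc[OF R0] by (intro exI[of _ "\<lambda>_. 1"]) auto
  next
    case (grow P p s)
    from grow.IH obtain c where c: "\<And>e. e \<in> E \<Longrightarrow> e \<inter> P \<noteq> {} \<Longrightarrow> R (card P) (c e)"
      "\<And>s. s \<in> S \<Longrightarrow> s \<in> P \<Longrightarrow> (\<Sum>v\<in>neighbours E s. c {s, v} * d s v) = 0" by blast
    have card: "card (insert s P) = Suc (card P)"
      using grow.hyps finV finite_subset by (metis card_insert_disjoint)
    have ps: "{s, p} \<in> E" using grow.hyps(6) by (simp add: insert_commute)
    have at_s: "\<exists>v. v \<in> neighbours E s \<and> e = {s, v}" if e: "e \<in> E" "s \<in> e" for e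
    proof -
      obtain a b where "e = {a, b}" using sg e(1) by (rule edge_cases)
      then show ?thesis using e by (auto simp: neighbours_def insert_commute)
    qed
    show ?case
    proof (cases "s \<in> S")
      case False
      then have "card (neighbours E s) = 1"
        using leaf grow.hyps(4) card_neighbours[OF sg] by simp
      moreover have "p \<in> neighbours E s" using ps by (simp add: neighbours_def)
      ultimately have "neighbours E s = {p}" by (metis card_1_singletonE singletonD)
      then have "e \<inter> P \<noteq> {}" if "e \<in> E" "e \<inter> insert s P \<noteq> {}" for e
        using that at_s grow.hyps(3) by fastforce
      then have "R (Suc (card P)) (c e)" if "e \<in> E" "e \<inter> insert s P \<noteq> {}" for e
        using that c(1) R_Suc by blast
      then show ?thesis unfolding card using c(2) False by (intro exI[of _ c]) auto
    next
      case True
      then obtain a b \<mu> \<nu> where ab: "neighbours E s = {p, a, b}" "p \<noteq> a" "p \<noteq> b" "a \<noteq> b"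
        and bal: "d s p + \<mu> * d s a + \<nu> * d s b = 0"
        and mult: "\<And>k c. R k c \<Longrightarrow> R (Suc k) (c * \<mu>)" "\<And>k c. R k c \<Longrightarrow> R (Suc k) (c * \<nu>)"
        using branch[OF True ps] by blast
      have "{a, s} \<in> E" "{b, s} \<in> E"
        using ab(1) by (auto simp: neighbours_def insert_commute)
      then have new: "a \<notin> P" "b \<notin> P" using grow.hyps(7)[of a] grow.hyps(7)[of b] ab(2,3) by auto
      have ns: "a \<noteq> s" "b \<noteq> s" using \<open>{a, s} \<in> E\<close> \<open>{b, s} \<in> E\<close> edge_vertices[OF sg] by blast+
      define c' where "c' = c({s, a} := c {s, p} * \<mu>, {s, b} := c {s, p} * \<nu>)"
      have old: "c' e = c e" if "e \<inter> P \<noteq> {}" for e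
        using that new grow.hyps(5) by (auto simp: c'_def)
      have csp: "R (card P) (c {s, p})" using c(1)[OF ps] grow.hyps(3) by auto
      have c'ab: "c' {s, a} = c {s, p} * \<mu>" "c' {s, b} = c {s, p} * \<nu>" "c' {s, p} = c {s, p}"
        using ab ns grow.hyps(3) old by (auto simp: c'_def doubleton_eq_iff)
      have "R (Suc (card P)) (c' e)" if e: "e \<in> E" "e \<inter> insert s P \<noteq> {}" for e
      proof (cases "e \<inter> P = {}")
        case False
        then show ?thesis using old c(1)[OF e(1)] R_Suc by simp
      next
        case T: True
        then obtain v where "v \<in> neighbours E s" "e = {s, v}" using at_s e by blast
        then have "e = {s, a} \<or> e = {s, b}" using ab(1) T grow.hyps(3) by auto
        then show ?thesis using mult csp c'ab by auto
      qed
      moreover have "(\<Sum>v\<in>neighbours E q. c' {q, v} * d q v) = 0" if q: "q \<in> S" "q \<in> insert s P" for q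
      proof (cases "q = s")
        case True
        have "(\<Sum>v\<in>neighbours E s. c' {s, v} * d s v) =
              c {s, p} * (d s p + \<mu> * d s a + \<nu> * d s b)"
          using ab by (simp add: c'ab algebra_simps)
        then show ?thesis using bal True by simp
      next
        case False
        then have "q \<in> P" using q by simp
        then have "c' {q, v} = c {q, v}" for v by (intro old) auto
        then show ?thesis using c(2)[OF q(1) \<open>q \<in> P\<close>] by simp
      qed
      ultimately show ?thesis unfolding card by (intro exI[of _ c']) auto
    qed
  qed
  moreover have "e \<inter> V \<noteq> {}" if "e \<in> E" for e
    using that sg unfolding simple_graph_def by (metis Int_absorb2 card.empty zero_neq_numeral)
  ultimately show ?thesis by meson
qed

section \<open>Angles close to 120 degrees\<close>

text \<open>
  Propagation combined with duality, for a full approximate tree in the plane. A multiplier \<open>c\<close>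
  contributes \<open>Re c\<close> times the length of the edge to the pairing, and \<open>|c|\<close> bounds the flow.
\<close>

lemma tree_length_bound_by_multipliers:
  fixes x y :: "nat \<Rightarrow> complex"
  assumes top: "steiner_topology n V E" and full: "full_topology n E" and n: "1 \<le> n"
    and angles: "approx_angles \<epsilon> n V E x" and eq: "\<And>t. t \<in> {1..n} \<Longrightarrow> x t = y t"
    and R0: "R 0 1" and R_Suc: "\<And>k c. R k c \<Longrightarrow> R (Suc k) c"
    and corr: "\<And>\<alpha> \<beta> \<gamma>. norm \<alpha> = 1 \<Longrightarrow> norm \<beta> = 1 \<Longrightarrow> norm \<gamma> = 1 \<Longrightarrow>
       \<bar>\<alpha> \<bullet> \<beta> + 1 / 2\<bar> \<le> \<epsilon> \<Longrightarrow> \<bar>\<alpha> \<bullet> \<gamma> + 1 / 2\<bar> \<le> \<epsilon> \<Longrightarrow> \<bar>\<beta> \<bullet> \<gamma> + 1 / 2\<bar> \<le> \<epsilon> \<Longrightarrow>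
       \<exists>\<mu> \<nu>. \<alpha> + \<mu> * \<beta> + \<nu> * \<gamma> = 0 \<and>
         (\<forall>k c. R k c \<longrightarrow> R (Suc k) (c * \<mu>) \<and> R (Suc k) (c * \<nu>))"
    and bound: "\<And>c. R (card V) c \<Longrightarrow> \<rho> \<le> Re c \<and> norm c \<le> M"
  shows "\<rho> * tree_length E x \<le> M * tree_length E y"
proof -
  have tree: "graph_tree V E" and sub: "{1..n} \<subseteq> V"
    and st: "\<And>s. s \<in> V - {1..n} \<Longrightarrow> degree E s = 3"
    using top by (auto simp: steiner_topology_def)
  have sg: "simple_graph V E" using tree by (simp add: graph_tree_def)
  define d where "d u v = sgn (x v - x u)" for u v
  have "\<exists>c. (\<forall>e\<in>E. R (card V) (c e)) \<and>
             (\<forall>s\<in>(V - {1..n}) \<inter> V. (\<Sum>v\<in>neighbours E s. c {s, v} * d s v) = 0)"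
  proof (rule multiplier_propagation[OF tree])
    show "1 \<in> V" "1 \<notin> V - {1..n}" using sub n by auto
    show "degree E v = 1" if "v \<in> V" "v \<notin> V - {1..n}" for v
      using full that unfolding full_topology_def by blast
    show "R 0 1" by (rule R0)
    show "R (Suc k) c" if "R k c" for k c using that by (rule R_Suc)
  next
    fix s p assume s: "s \<in> V - {1..n}" and sp: "{s, p} \<in> E"
    obtain a b where ab: "neighbours E s = {p, a, b}" "p \<noteq> a" "p \<noteq> b" "a \<noteq> b"
      using sg st[OF s] sp by (rule steiner_neighbours)
    then have sa: "{s, a} \<in> E" and sb: "{s, b} \<in> E" by (auto simp: neighbours_def)
    have unit: "norm (d s v) = 1" if "{s, v} \<in> E" for v
      using angles s that unfolding approx_angles_def d_def by (auto simp: norm_sgn)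
    have near: "\<bar>d s u \<bullet> d s v + 1 / 2\<bar> \<le> \<epsilon>" if "{s, u} \<in> E" "{s, v} \<in> E" "u \<noteq> v" for u v
      using angles s that unfolding approx_angles_def d_def by (intro inner_sgn_near_half) blast
    obtain \<mu> \<nu> where "d s p + \<mu> * d s a + \<nu> * d s b = 0"
      "\<forall>k c. R k c \<longrightarrow> R (Suc k) (c * \<mu>) \<and> R (Suc k) (c * \<nu>)"
      using corr[OF unit[OF sp] unit[OF sa] unit[OF sb] near[OF sp sa ab(2)] near[OF sp sb ab(3)]
          near[OF sa sb ab(4)]] by blast
    then show "\<exists>a b \<mu> \<nu>. neighbours E s = {p, a, b} \<and> p \<noteq> a \<and> p \<noteq> b \<and> a \<noteq> b \<and>
         d s p + \<mu> * d s a + \<nu> * d s b = 0 \<and>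
         (\<forall>k c. R k c \<longrightarrow> R (Suc k) (c * \<mu>) \<and> R (Suc k) (c * \<nu>))"
      using ab by blast
  qed
  then obtain c where c: "\<And>e. e \<in> E \<Longrightarrow> R (card V) (c e)"
    and bal: "\<And>s. s \<in> V - {1..n} \<Longrightarrow> (\<Sum>v\<in>neighbours E s. c {s, v} * d s v) = 0" by blast
  show ?thesis
  proof (rule tree_length_lower_bound_by_flow[OF sg _ bal eq])
    show "c {v, u} * d v u = - (c {u, v} * d u v)" for u v
    proof -
      have "d v u = - d u v" unfolding d_def by (metis minus_diff_eq sgn_minus)
      then show ?thesis by (simp add: insert_commute)
    qed
  next
    fix u v assume e: "{u, v} \<in> E"
    have "norm (d u v) \<le> 1" by (simp add: d_def norm_sgn)
    then have "norm (c {u, v} * d u v) \<le> norm (c {u, v}) * 1"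
      unfolding norm_mult by (intro mult_left_mono) auto
    then show "norm (c {u, v} * d u v) \<le> M" using bound[OF c[OF e]] by simp
    have "(a * sgn z) \<bullet> z = Re a * norm z" for a z :: complex
    proof (cases "z = 0")
      case False
      have "(a * sgn z) \<bullet> z = (Re a * ((Re z)\<^sup>2 + (Im z)\<^sup>2)) / norm z"
        by (simp add: sgn_eq inner_complex_def power2_eq_square add_divide_distrib
            diff_divide_distrib algebra_simps)
      also have "\<dots> = Re a * norm z"
        unfolding cmod_power2[symmetric] using False by (simp add: power2_eq_square)
      finally show ?thesis .
    qed simp
    then have "(c {u, v} * d u v) \<bullet> (x v - x u) = Re (c {u, v}) * dist (x u) (x v)"
      by (simp add: d_def dist_norm norm_minus_commute)
    then show "\<rho> * dist (x u) (x v) \<le> (c {u, v} * d u v) \<bullet> (x v - x u)"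
      using bound[OF c[OF e]] by (simp add: mult_right_mono)
  qed
qed

text \<open>Unimodular corrections give a bound of second order as long as \<open>n\<epsilon>\<close> is small.\<close>

lemma relative_error_quadratic:
  fixes x y :: "nat \<Rightarrow> complex"
  assumes top: "steiner_topology n V E" and full: "full_topology n E" and n: "1 \<le> n"
    and angles: "approx_angles \<epsilon> n V E x" and eq: "\<And>t. t \<in> {1..n} \<Longrightarrow> x t = y t"
    and eps: "0 \<le> \<epsilon>" "real n * \<epsilon> \<le> 1 / 6"
  shows "tree_length E x \<le> (1 + 36 * (real n)\<^sup>2 * \<epsilon>\<^sup>2) * tree_length E y"
proof -
  define t where "t = (real n)\<^sup>2 * \<epsilon>\<^sup>2"
  have "t = (real n * \<epsilon>)\<^sup>2" by (simp add: t_def power_mult_distrib)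
  moreover have "(real n * \<epsilon>)\<^sup>2 \<le> (1 / 6)\<^sup>2" using eps by (intro power_mono) auto
  ultimately have t: "0 \<le> t" "t \<le> 1 / 36" by (simp_all add: power_divide)
  have "1 * \<epsilon> \<le> real n * \<epsilon>" using n eps by (intro mult_right_mono) auto
  then have eps6: "\<epsilon> \<le> 1 / 6" using eps by linarith
  have card: "real (card V) \<le> 2 * real n"
    using full_topology_card_vertices[OF top full] by linarith
  have "(1 - 18 * t) * tree_length E x \<le> 1 * tree_length E y"
  proof (rule tree_length_bound_by_multipliers[where
        R = "\<lambda>k c. norm c = 1 \<and> norm (c - 1) \<le> 3 * \<epsilon> * real k", OF top full n angles eq])
    show "norm c = 1 \<and> norm (c - 1) \<le> 3 * \<epsilon> * real (Suc k)"
      if "norm c = 1 \<and> norm (c - 1) \<le> 3 * \<epsilon> * real k" for k and c :: complex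
      using that eps(1) by (simp add: algebra_simps)
  next
    fix \<alpha> \<beta> \<gamma> :: complex
    assume "norm \<alpha> = 1" "norm \<beta> = 1" "norm \<gamma> = 1"
      "\<bar>\<alpha> \<bullet> \<beta> + 1 / 2\<bar> \<le> \<epsilon>" "\<bar>\<alpha> \<bullet> \<gamma> + 1 / 2\<bar> \<le> \<epsilon>" "\<bar>\<beta> \<bullet> \<gamma> + 1 / 2\<bar> \<le> \<epsilon>"
    then obtain \<mu> \<nu> where \<mu>: "\<alpha> + \<mu> * \<beta> + \<nu> * \<gamma> = 0" "norm \<mu> = 1" "norm \<nu> = 1"
        "norm (\<mu> - 1) \<le> 3 * \<epsilon>" "norm (\<nu> - 1) \<le> 3 * \<epsilon>"
      using unimodular_correction[OF _ _ _ eps6] by blast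
    have "norm (c * z) = 1 \<and> norm (c * z - 1) \<le> 3 * \<epsilon> * real (Suc k)"
      if "norm c = 1" "norm (c - 1) \<le> 3 * \<epsilon> * real k" "norm z = 1" "norm (z - 1) \<le> 3 * \<epsilon>"
      for c z :: complex and k
    proof
      have "c * z - 1 = c * (z - 1) + (c - 1)" by (simp add: algebra_simps)
      then have "norm (c * z - 1) \<le> norm (c * (z - 1)) + norm (c - 1)" by (metis norm_triangle_ineq)
      then show "norm (c * z - 1) \<le> 3 * \<epsilon> * real (Suc k)"
        using that unfolding norm_mult by (simp add: distrib_left)
    qed (use that in \<open>simp add: norm_mult\<close>)
    then show "\<exists>\<mu> \<nu>. \<alpha> + \<mu> * \<beta> + \<nu> * \<gamma> = 0 \<and>
      (\<forall>k c. norm c = 1 \<and> norm (c - 1) \<le> 3 * \<epsilon> * real k \<longrightarrow>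
        (norm (c * \<mu>) = 1 \<and> norm (c * \<mu> - 1) \<le> 3 * \<epsilon> * real (Suc k)) \<and>
        (norm (c * \<nu>) = 1 \<and> norm (c * \<nu> - 1) \<le> 3 * \<epsilon> * real (Suc k)))"
      using \<mu> by (intro exI[of _ \<mu>] exI[of _ \<nu>]) blast
  next
    fix c :: complex
    assume c: "norm c = 1 \<and> norm (c - 1) \<le> 3 * \<epsilon> * real (card V)"
    have "3 * \<epsilon> * real (card V) \<le> 3 * \<epsilon> * (2 * real n)"
      using card eps by (intro mult_left_mono) auto
    then have "(norm (c - 1))\<^sup>2 \<le> (6 * \<epsilon> * real n)\<^sup>2" using c by (intro power_mono) auto
    moreover have "(norm (c - 1))\<^sup>2 = 2 - 2 * Re c"
    proof -
      have "(Re c)\<^sup>2 + (Im c)\<^sup>2 = 1" using c cmod_power2[of c] by simp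
      then show ?thesis unfolding cmod_power2 by (simp add: power2_eq_square algebra_simps)
    qed
    ultimately show "1 - 18 * t \<le> Re c \<and> norm c \<le> 1"
      using c by (simp add: t_def power_mult_distrib algebra_simps)
  qed auto
  then have *: "(1 - 18 * t) * tree_length E x \<le> tree_length E y" by simp
  have "1 \<le> (1 + 36 * t) * (1 - 18 * t)"
  proof -
    have "t * (1 - 36 * t) \<ge> 0" using t by simp
    then show ?thesis by (simp add: algebra_simps)
  qed
  then have "1 * tree_length E x \<le> (1 + 36 * t) * (1 - 18 * t) * tree_length E x"
    by (intro mult_right_mono tree_length_nonneg)
  also have "\<dots> \<le> (1 + 36 * t) * tree_length E y"
    unfolding mult.assoc using * t by (intro mult_left_mono) auto
  finally show ?thesis by (simp add: t_def mult.assoc)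
qed

text \<open>
  Positive corrections give a bound without any restriction on \<open>n\<epsilon>\<close>. It is only of first order for
  small \<open>n\<epsilon>\<close>.
\<close>

lemma relative_error_exponential:
  fixes x y :: "nat \<Rightarrow> complex"
  assumes top: "steiner_topology n V E" and full: "full_topology n E" and n: "1 \<le> n"
    and angles: "approx_angles \<epsilon> n V E x" and eq: "\<And>t. t \<in> {1..n} \<Longrightarrow> x t = y t"
    and eps: "0 \<le> \<epsilon>" "\<epsilon> \<le> 1 / 100"
  shows "tree_length E x \<le> exp (24 * real n * \<epsilon>) * tree_length E y"
proof -
  define q where "q = 1 + 6 * \<epsilon>"
  have q: "q \<ge> 1" using eps by (simp add: q_def)
  let ?R = "\<lambda>k c. Im c = 0 \<and> 0 \<le> Re c \<and> 1 \<le> Re c * q ^ k \<and> Re c \<le> q ^ k"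
  have "(1 / q ^ card V) * tree_length E x \<le> q ^ card V * tree_length E y"
  proof (rule tree_length_bound_by_multipliers[where R = ?R, OF top full n angles eq])
    fix k c assume c: "?R k c"
    have "1 * q ^ k \<le> q * q ^ k" using q by (intro mult_right_mono) auto
    moreover from this have "Re c * (1 * q ^ k) \<le> Re c * (q * q ^ k)"
      using c by (intro mult_left_mono) auto
    ultimately show "?R (Suc k) c" using c by auto
  next
    fix \<alpha> \<beta> \<gamma> :: complex
    assume "norm \<alpha> = 1" "norm \<beta> = 1" "norm \<gamma> = 1"
      "\<bar>\<alpha> \<bullet> \<beta> + 1 / 2\<bar> \<le> \<epsilon>" "\<bar>\<alpha> \<bullet> \<gamma> + 1 / 2\<bar> \<le> \<epsilon>" "\<bar>\<beta> \<bullet> \<gamma> + 1 / 2\<bar> \<le> \<epsilon>"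
    then obtain l m :: real where lm: "\<alpha> + of_real l * \<beta> + of_real m * \<gamma> = 0"
        "\<bar>l - 1\<bar> \<le> 5 * \<epsilon>" "\<bar>m - 1\<bar> \<le> 5 * \<epsilon>"
      using positive_correction[OF _ _ _ eps(2)] by blast
    have "?R (Suc k) (c * of_real a)" if c: "?R k c" and a: "\<bar>a - 1\<bar> \<le> 5 * \<epsilon>" for k c a
    proof -
      have a': "0 \<le> a" "a \<le> q" "1 - 5 * \<epsilon> \<le> a" using a eps by (auto simp: q_def)
      have "\<epsilon> * (1 - 30 * \<epsilon>) \<ge> 0" using eps by simp
      then have "1 \<le> (1 - 5 * \<epsilon>) * q" by (simp add: q_def algebra_simps)
      also have "\<dots> \<le> a * q" using a' q by (intro mult_right_mono) auto
      finally have "1 * 1 \<le> (Re c * q ^ k) * (a * q)" using c by (intro mult_mono) auto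
      moreover have "Re c * a \<le> q ^ k * q" using c a' q by (intro mult_mono) auto
      ultimately show ?thesis using c a' by (simp add: mult_ac)
    qed
    then show "\<exists>\<mu> \<nu>. \<alpha> + \<mu> * \<beta> + \<nu> * \<gamma> = 0 \<and>
         (\<forall>k c. ?R k c \<longrightarrow> ?R (Suc k) (c * \<mu>) \<and> ?R (Suc k) (c * \<nu>))"
      using lm by (intro exI[of _ "of_real l"] exI[of _ "of_real m"]) blast
  next
    fix c assume c: "?R (card V) c"
    then have "norm c = Re c" by (simp add: cmod_eq_Re)
    then show "1 / q ^ card V \<le> Re c \<and> norm c \<le> q ^ card V"
      using c q by (simp add: divide_le_eq)
  qed auto
  then have "q ^ card V * ((1 / q ^ card V) * tree_length E x) \<le> q ^ card V * (q ^ card V * tree_length E y)"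
    using q by (intro mult_left_mono) auto
  then have "tree_length E x \<le> (q ^ card V * q ^ card V) * tree_length E y"
    using q by simp
  also have "\<dots> \<le> exp (24 * real n * \<epsilon>) * tree_length E y"
  proof (intro mult_right_mono tree_length_nonneg)     have "q ^ card V * q ^ card V = q ^ (2 * card V)" by (simp add: power_add mult_2)
    also have "\<dots> \<le> q ^ (4 * n)"
      using full_topology_card_vertices[OF top full] q by (intro power_increasing) auto
    also have "\<dots> \<le> exp (6 * \<epsilon>) ^ (4 * n)"
      using q by (intro power_mono) (auto simp: q_def)
    also have "\<dots> = exp (24 * real n * \<epsilon>)"
      by (simp add: exp_of_nat_mult[symmetric] algebra_simps)
    finally show "q ^ card V * q ^ card V \<le> exp (24 * real n * \<epsilon>)" .
  qed
  finally show ?thesis .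
qed

section \<open>Angles bounded away from zero\<close>

text \<open>
  If all angles at Steiner points are at least \<open>\<eta>\<close>, then every vertex is close to a terminal on the scale
  of an upper bound \<open>D\<close> for the distances between terminals. The estimate passes from the leaves
  inwards, while the induction grows a set \<open>P\<close> from a root outwards. So the invariant is conditional:
  if the vertices just outside \<open>P\<close> are close to terminals, then so are those in \<open>P\<close>, with a constant
  that grows by a factor \<open>K\<close> for each vertex of \<open>P\<close>.
\<close>

lemma near_terminals_of_angles_bounded_below:
  fixes x :: "nat \<Rightarrow> 'a::euclidean_space"
  assumes top: "steiner_topology n V E" and n: "1 \<le> n"
    and \<eta>: "0 < \<eta>" "\<eta> \<le> pi / 2"
    and angles: "\<And>s u v. s \<in> V - {1..n} \<Longrightarrow> {s, u} \<in> E \<Longrightarrow> {s, v} \<in> E \<Longrightarrow> u \<noteq> v \<Longrightarrow>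
      \<eta> \<le> vec_angle (x u - x s) (x v - x s)"
    and D: "\<And>i j. i \<in> {1..n} \<Longrightarrow> j \<in> {1..n} \<Longrightarrow> dist (x i) (x j) \<le> D"
    and v: "v \<in> V"
  shows "\<exists>t\<in>{1..n}. dist (x v) (x t) \<le> (1 + 3 / sin \<eta>) ^ card V * D"
proof -
  have tree: "graph_tree V E" and sub: "{1..n} \<subseteq> V"
    and st: "\<And>s. s \<in> V - {1..n} \<Longrightarrow> degree E s = 3"
    using top by (auto simp: steiner_topology_def)
  have sg: "simple_graph V E" using tree by (simp add: graph_tree_def)
  have finV: "finite V" using sg by (simp add: simple_graph_def)
  have sin: "sin \<eta> > 0" using \<eta> by (intro sin_gt_zero) auto
  define K where "K = 1 + 3 / sin \<eta>"
  have K: "K \<ge> 1" using sin by (simp add: K_def)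
  have D0: "D \<ge> 0" using D[of 1 1] n by simp
  define near where "near v k \<longleftrightarrow> (\<exists>t\<in>{1..n}. dist (x v) (x t) \<le> k * D)" for v k
  have near_mono: "near v k'" if "near v k" "k \<le> k'" for v k k'
    using that D0 mult_right_mono[OF that(2) D0] unfolding near_def by (meson order_trans)
  have near_terminal: "near t k" if "t \<in> {1..n}" "0 \<le> k" for t k
    unfolding near_def using that D0 by (intro bexI[of _ t]) auto
  have near_step: "near s (K * k)" if s: "s \<in> V - {1..n}" and e: "{s, a} \<in> E" "{s, b} \<in> E" "a \<noteq> b"
    and ab: "near a k" "near b k" and k: "1 \<le> k" for s a b k
  proof -
    obtain t u where t: "t \<in> {1..n}" "dist (x a) (x t) \<le> k * D"
      and u: "u \<in> {1..n}" "dist (x b) (x u) \<le> k * D" using ab unfolding near_def by blast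
    \<comment> \<open>The vertices \<open>a\<close> and \<open>b\<close> are close to each other and seen from \<open>s\<close> under an angle of at least \<open>\<eta>\<close>.\<close>
    have "norm (x a - x s) * sin \<eta> \<le> norm ((x a - x s) - (x b - x s))"
      by (rule norm_mult_sin_le_of_angle) (use \<eta> angles[OF s e] in auto)
    also have "\<dots> = dist (x a) (x b)" by (simp add: dist_norm)
    also have "\<dots> \<le> dist (x a) (x t) + dist (x t) (x u) + dist (x b) (x u)"
      using dist_triangle[of "x a" "x b" "x t"] dist_triangle[of "x t" "x b" "x u"]
      by (simp add: dist_commute)
    also have "\<dots> \<le> 3 * (k * D)"
      using t u D[OF t(1) u(1)] mult_right_mono[OF k D0] by linarith
    finally have "dist (x s) (x a) \<le> (3 / sin \<eta>) * (k * D)"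
      using sin by (simp add: dist_norm norm_minus_commute field_simps)
    then have "dist (x s) (x t) \<le> (3 / sin \<eta>) * (k * D) + k * D"
      using t(2) dist_triangle[of "x s" "x t" "x a"] by linarith
    also have "\<dots> = (K * k) * D" by (simp add: K_def algebra_simps)
    finally show ?thesis using t(1) unfolding near_def by blast
  qed
  define boundary where
    "boundary P k \<longleftrightarrow> (\<forall>u\<in>V - P. (\<exists>p\<in>P. {p, u} \<in> E) \<longrightarrow> near u k)" for P k
  have one: "1 \<in> V" using sub n by auto
  have "\<forall>k\<ge>1. boundary V k \<longrightarrow> (\<forall>p\<in>V. near p (K ^ card V * k))"
    using tree one
  proof (induction rule: tree_growth_induct)
    case root
    show ?case using near_terminal n K by auto
  next
    case (grow P p s)
    have card: "card (insert s P) = Suc (card P)"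
      using grow.hyps(1,5) finV finite_subset by (metis card_insert_disjoint)
    have sp: "{s, p} \<in> E" using grow.hyps(6) by (simp add: insert_commute)
    show ?case
    proof (intro allI impI)
      fix k :: real assume k: "1 \<le> k" and bd: "boundary (insert s P) k"
      have kK: "k \<le> K * k" using K k by simp
      have s_near: "near s (K * k)"
      proof (cases "s \<in> {1..n}")
        case True then show ?thesis using near_terminal K k by simp
      next
        case False
        then have s: "s \<in> V - {1..n}" using grow.hyps(4) by blast
        obtain a b where ab: "neighbours E s = {p, a, b}" "p \<noteq> a" "p \<noteq> b" "a \<noteq> b"
          using sg st[OF s] sp by (rule steiner_neighbours)
        then have e: "{s, a} \<in> E" "{s, b} \<in> E" by (auto simp: neighbours_def)
        have "near c k" if c: "{s, c} \<in> E" "c \<noteq> p" for c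
        proof -
          have "c \<in> V" "c \<noteq> s" using edge_vertices[OF sg c(1)] by auto
          moreover have "c \<notin> P" using grow.hyps(7)[of c] c by (auto simp: insert_commute)
          ultimately show ?thesis using bd c(1) unfolding boundary_def by blast
        qed
        then show ?thesis using near_step[OF s e ab(4) _ _ k] e ab(2,3) by blast
      qed
      have "boundary P (K * k)"
        unfolding boundary_def
      proof (intro ballI impI)
        fix u assume u: "u \<in> V - P" "\<exists>p\<in>P. {p, u} \<in> E"
        show "near u (K * k)"
        proof (cases "u = s")
          case False
          then have "near u k" using u bd unfolding boundary_def by blast
          then show ?thesis using near_mono kK by blast
        qed (use s_near in simp)
      qed
      then have P: "near q (K ^ card P * (K * k))" if "q \<in> P" for q
        using grow.IH kK k that order_trans by blast
      have "1 * (K * k) \<le> K ^ card P * (K * k)"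
        using K k by (intro mult_right_mono one_le_power) auto
      then have "near s (K ^ card P * (K * k))" using near_mono[OF s_near] by simp
      then show "\<forall>q\<in>insert s P. near q (K ^ card (insert s P) * k)"
        using P unfolding card by (simp add: mult_ac)
    qed
  qed
  moreover have "boundary V 1" by (simp add: boundary_def)
  ultimately have "near v (K ^ card V * 1)" using v by blast
  then show ?thesis by (simp add: near_def K_def)
qed

lemma tree_length_le_of_angles_bounded_below:
  fixes x :: "nat \<Rightarrow> 'a::euclidean_space"
  assumes top: "steiner_topology n V E" and n: "1 \<le> n"
    and \<eta>: "0 < \<eta>" "\<eta> \<le> pi / 2"
    and angles: "\<And>s u v. s \<in> V - {1..n} \<Longrightarrow> {s, u} \<in> E \<Longrightarrow> {s, v} \<in> E \<Longrightarrow> u \<noteq> v \<Longrightarrow>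
      \<eta> \<le> vec_angle (x u - x s) (x v - x s)"
    and eq: "\<And>t. t \<in> {1..n} \<Longrightarrow> x t = y t"
  shows "tree_length E x \<le> 3 * (real (card V))\<^sup>2 * (1 + 3 / sin \<eta>) ^ card V * tree_length E y"
proof -
  have tree: "graph_tree V E" and sub: "{1..n} \<subseteq> V"
    using top by (auto simp: steiner_topology_def)
  have sg: "simple_graph V E" using tree by (simp add: graph_tree_def)
  have finV: "finite V" using sg by (simp add: simple_graph_def)
  have sin: "sin \<eta> > 0" using \<eta> by (intro sin_gt_zero) auto
  define D where "D = tree_length E y"
  define M where "M = (1 + 3 / sin \<eta>) ^ card V"
  have D0: "D \<ge> 0" by (simp add: D_def tree_length_nonneg)
  have "M \<ge> 1" unfolding M_def using sin by (intro one_le_power) auto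
  then have MD: "D \<le> M * D" using D0 by (simp add: mult_le_cancel_right1)
  have D: "dist (x i) (x j) \<le> D" if "i \<in> {1..n}" "j \<in> {1..n}" for i j
    using dist_le_tree_length[OF tree subsetD[OF sub that(1)] subsetD[OF sub that(2)], of y]
      eq that by (simp add: D_def)
  have near: "\<exists>t\<in>{1..n}. dist (x v) (x t) \<le> M * D" if "v \<in> V" for v
    unfolding M_def using near_terminals_of_angles_bounded_below[OF top n \<eta> angles D that] .
  have edge: "dist (x u) (x v) \<le> 3 * (M * D)" if uv: "u \<in> V" "v \<in> V" for u v
  proof -
    obtain s t where st: "s \<in> {1..n}" "dist (x u) (x s) \<le> M * D" "t \<in> {1..n}" "dist (x v) (x t) \<le> M * D"
      using near[OF uv(1)] near[OF uv(2)] by blast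
    have "dist (x u) (x v) \<le> dist (x u) (x s) + dist (x s) (x v)" by (rule dist_triangle)
    moreover have "dist (x s) (x v) \<le> dist (x s) (x t) + dist (x v) (x t)" by (rule dist_triangle2)
    ultimately show ?thesis using st D[OF st(1,3)] MD by linarith
  qed
  let ?A = "{(u, v). u < v \<and> {u, v} \<in> E}"
  have A: "?A \<subseteq> V \<times> V" using edge_vertices[OF sg] by auto
  have "tree_length E x \<le> real (card ?A) * (3 * (M * D))"
    unfolding tree_length_def by (rule sum_bounded_above) (use A edge in auto)
  also have "\<dots> \<le> real (card (V \<times> V)) * (3 * (M * D))"
  proof (rule mult_right_mono)
    have "card ?A \<le> card (V \<times> V)" using card_mono[OF _ A] finV by blast
    then show "real (card ?A) \<le> real (card (V \<times> V))" by (rule of_nat_mono)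
    show "0 \<le> 3 * (M * D)" using MD D0 by simp
  qed
  finally show ?thesis by (simp add: card_cartesian_product power2_eq_square M_def D_def mult_ac)
qed

section \<open>Existence of shortest trees\<close>

text \<open>
  Since each vertex is within the length of the tree of terminal \<open>1\<close>, only vertices in a fixed ball
  matter. Vertices outside \<open>V\<close> do not affect the length and are moved to that terminal (\<open>cut\<close>), so the
  competitors may be taken from a product of compact sets.
\<close>

lemma exists_shortest_tree:
  fixes x :: "nat \<Rightarrow> 'a::euclidean_space"
  assumes tree: "graph_tree V E" and sub: "{1..n} \<subseteq> V" and n: "1 \<le> n"
  shows "\<exists>m. (\<forall>i\<in>{1..n}. m i = x i) \<and>
           (\<forall>y. (\<forall>i\<in>{1..n}. y i = x i) \<longrightarrow> tree_length E m \<le> tree_length E y)"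
proof -
  have sg: "simple_graph V E" using tree by (simp add: graph_tree_def)
  define R where "R = tree_length E x"
  have R0: "R \<ge> 0" by (simp add: R_def tree_length_nonneg)
  define C where "C i = (if i \<in> {1..n} then {x i} else cball (x 1) R)" for i
  let ?K = "PiE UNIV C"
  have "compactin (product_topology (\<lambda>_::nat. euclidean :: 'a topology) UNIV) ?K"
    by (simp add: compactin_PiE C_def)
  then have comp: "compact ?K" by (simp add: euclidean_product_topology)
  define cut where "cut y i = (if i \<in> {1..n} then x i else if i \<in> V then y i else x 1)" for y i
  have cut_K: "cut y \<in> ?K" if "tree_length E y \<le> R" "\<forall>i\<in>{1..n}. y i = x i" for y
  proof -
    have "dist (x 1) (y i) \<le> R" if "i \<in> V" for i
      using dist_le_tree_length[OF tree _ that, of 1 y] \<open>tree_length E y \<le> R\<close>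
        \<open>\<forall>i\<in>{1..n}. y i = x i\<close> sub n by auto
    then show ?thesis using R0 by (auto simp: PiE_iff C_def cut_def)
  qed
  have cut_length: "tree_length E (cut y) = tree_length E y" if "\<forall>i\<in>{1..n}. y i = x i" for y
  proof -
    have "cut y i = y i" if "i \<in> V" for i using that \<open>\<forall>i\<in>{1..n}. y i = x i\<close> by (simp add: cut_def)
    then show ?thesis using edge_vertices[OF sg]
      unfolding tree_length_def by (intro sum.cong) auto
  qed
  have cont: "continuous_on ?K (tree_length E)"
    unfolding tree_length_def case_prod_beta
    by (intro continuous_on_sum continuous_on_dist
        continuous_on_subset[OF continuous_on_product_coordinates]) auto
  have "?K \<noteq> {}" using cut_K[of x] by (auto simp: R_def)
  then obtain m where m: "m \<in> ?K" "\<And>y. y \<in> ?K \<Longrightarrow> tree_length E m \<le> tree_length E y"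
    using continuous_attains_inf[OF comp _ cont] by blast
  have "tree_length E m \<le> tree_length E y" if y: "\<forall>i\<in>{1..n}. y i = x i" for y
  proof (cases "tree_length E y \<le> R")
    case True
    then show ?thesis using m(2)[OF cut_K[OF True y]] cut_length[OF y] by simp
  next
    case False
    moreover have "tree_length E m \<le> R"
      using m(2)[OF cut_K[of x]] cut_length[of x] by (simp add: R_def)
    ultimately show ?thesis by linarith
  qed
  moreover have "\<forall>i\<in>{1..n}. m i = x i"
  proof
    fix i assume "i \<in> {1..n}"
    moreover have "m i \<in> C i" using m(1) by (simp add: PiE_iff)
    ultimately show "m i = x i" by (simp add: C_def)
  qed
  ultimately show ?thesis by blast
qed

lemma shortest_tree_minimal:
  fixes x :: "nat \<Rightarrow> 'a::euclidean_space"
  assumes "graph_tree V E" and "{1..n} \<subseteq> V" and "1 \<le> n"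
  shows "\<And>i. i \<in> {1..n} \<Longrightarrow> shortest_tree n E x i = x i"
    and "(\<And>i. i \<in> {1..n} \<Longrightarrow> y i = x i) \<Longrightarrow> tree_length E (shortest_tree n E x) \<le> tree_length E y"
proof -
  let ?P = "\<lambda>y. \<forall>i\<in>{1..n}. y i = x i"
  let ?Q = "\<lambda>m. ?P m \<and> (\<forall>y. ?P y \<longrightarrow> tree_length E m \<le> tree_length E y)"
  obtain m where m: "?Q m" using exists_shortest_tree[OF assms] by blast
  have "?Q (shortest_tree n E x)"
    unfolding shortest_tree_def
    by (rule arg_minI[of ?P m]) (use m in \<open>auto simp: not_less\<close>)
  then show "\<And>i. i \<in> {1..n} \<Longrightarrow> shortest_tree n E x i = x i"
    and "(\<And>i. i \<in> {1..n} \<Longrightarrow> y i = x i) \<Longrightarrow> tree_length E (shortest_tree n E x) \<le> tree_length E y"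
    by blast+
qed

section \<open>An exact tree for every number of terminals\<close>

text \<open>
  The caterpillar with \<open>n\<close> terminals: the spine is the path \<open>n, n + 1, \<dots>, 2n - 2\<close> followed by \<open>n - 1\<close>,
  with the Steiner points \<open>n + 1, \<dots>, 2n - 2\<close> inside, and terminal \<open>j \<le> n - 2\<close> is attached to
  \<open>n + j\<close>. It is encoded by a parent function with root \<open>2n - 2\<close>; the minimum attaches the end
  terminal \<open>n - 1\<close> to the root.
\<close>

definition caterpillar_parent :: "nat \<Rightarrow> nat \<Rightarrow> nat" where
  "caterpillar_parent n v = (if v < n then min (v + n) (2 * n - 2) else v + 1)"

definition caterpillar_vertices :: "nat \<Rightarrow> nat set" where
  "caterpillar_vertices n = {1..2 * n - 2}"

definition caterpillar_edges :: "nat \<Rightarrow> nat set set" where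
  "caterpillar_edges n = (\<lambda>v. {v, caterpillar_parent n v}) ` (caterpillar_vertices n - {2 * n - 2})"

lemma caterpillar_tree:
  assumes "3 \<le> n"
  shows "graph_tree (caterpillar_vertices n) (caterpillar_edges n)"
  unfolding caterpillar_edges_def
  by (rule graph_tree_of_parent_function)
    (use assms in \<open>auto simp: caterpillar_vertices_def caterpillar_parent_def\<close>)

lemma caterpillar_edge_iff:
  "{s, u} \<in> caterpillar_edges n \<longleftrightarrow>
     (s \<in> {1..<2 * n - 2} \<and> u = caterpillar_parent n s) \<or> (u \<in> {1..<2 * n - 2} \<and> s = caterpillar_parent n u)"
  (is "?L \<longleftrightarrow> ?R")
proof
  assume ?L
  then obtain v where "v \<in> {1..2 * n - 2}" "v \<noteq> 2 * n - 2" "{s, u} = {v, caterpillar_parent n v}"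
    unfolding caterpillar_edges_def caterpillar_vertices_def by blast
  then show ?R by (auto simp: doubleton_eq_iff)
next
  assume ?R
  then show ?L
  proof
    assume "s \<in> {1..<2 * n - 2} \<and> u = caterpillar_parent n s"
    then show ?L unfolding caterpillar_edges_def caterpillar_vertices_def by (intro image_eqI[of _ _ s]) auto
  next
    assume "u \<in> {1..<2 * n - 2} \<and> s = caterpillar_parent n u"
    then show ?L unfolding caterpillar_edges_def caterpillar_vertices_def
      by (intro image_eqI[of _ _ u]) (auto simp: insert_commute)
  qed
qed

lemma caterpillar_neighbours_terminal:
  assumes "3 \<le> n" "t \<in> {1..n}"
  shows "neighbours (caterpillar_edges n) t = {caterpillar_parent n t}"
proof -
  have "t \<noteq> caterpillar_parent n u" if "u \<in> {1..<2 * n - 2}" for u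
    using assms that by (auto simp: caterpillar_parent_def min_def split: if_splits)
  moreover have "t \<in> {1..<2 * n - 2}" using assms by auto
  ultimately show ?thesis unfolding neighbours_def caterpillar_edge_iff by blast
qed

text \<open>The vertex that follows a Steiner point on the spine.\<close>

definition caterpillar_next :: "nat \<Rightarrow> nat \<Rightarrow> nat" where
  "caterpillar_next n s = (if s = 2 * n - 2 then n - 1 else s + 1)"

lemma caterpillar_neighbours_steiner:
  assumes "3 \<le> n" "n < s" "s \<le> 2 * n - 2"
  shows "neighbours (caterpillar_edges n) s = {s - n, s - 1, caterpillar_next n s}"
proof -
  have "(s \<in> {1..<2 * n - 2} \<and> u = caterpillar_parent n s) \<or> (u \<in> {1..<2 * n - 2} \<and> s = caterpillar_parent n u)
      \<longleftrightarrow> u = s - n \<or> u = s - 1 \<or> u = caterpillar_next n s" for u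
    using assms unfolding caterpillar_parent_def caterpillar_next_def min_def
    by (cases "s = 2 * n - 2"; cases "u < n"; cases "u + n \<le> 2 * n - 2") auto
  then show ?thesis unfolding neighbours_def caterpillar_edge_iff by blast
qed

lemma caterpillar_topology:
  assumes "3 \<le> n"
  shows "steiner_topology n (caterpillar_vertices n) (caterpillar_edges n)" "full_topology n (caterpillar_edges n)"
proof -
  have sg: "simple_graph (caterpillar_vertices n) (caterpillar_edges n)"
    using caterpillar_tree[OF assms] by (simp add: graph_tree_def)
  have t: "degree (caterpillar_edges n) t = 1" if "t \<in> {1..n}" for t
    using card_neighbours[OF sg, of t] caterpillar_neighbours_terminal[OF assms that] by simp
  have s: "degree (caterpillar_edges n) s = 3" if "s \<in> caterpillar_vertices n - {1..n}" for s
  proof -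
    have s: "n < s" "s \<le> 2 * n - 2" using that by (auto simp: caterpillar_vertices_def)
    have "s - n \<noteq> s - 1" "s - n \<noteq> caterpillar_next n s" "s - 1 \<noteq> caterpillar_next n s"
      using assms s by (auto simp: caterpillar_next_def)
    then show ?thesis
      using card_neighbours[OF sg, of s] caterpillar_neighbours_steiner[OF assms s] by simp
  qed
  show "full_topology n (caterpillar_edges n)" using t by (simp add: full_topology_def)
  show "steiner_topology n (caterpillar_vertices n) (caterpillar_edges n)"
    unfolding steiner_topology_def
    using caterpillar_tree[OF assms] t s assms by (auto simp: caterpillar_vertices_def)
qed

lemma vec_angle_120:
  assumes "norm u = 1" "norm v = 1" "u \<bullet> v = - 1 / 2"
  shows "vec_angle u v = 2 * pi / 3"
proof -
  have "arccos (cos (2 * pi / 3)) = 2 * pi / 3" by (rule arccos_cos) auto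
  then show ?thesis using assms by (simp add: vec_angle_def cos_120)
qed

text \<open>
  The caterpillar is drawn as a zigzag with exact angles: for unit vectors \<open>a, b, c\<close> at 120 degrees,
  the three edges leave the Steiner points \<open>n + j\<close> with even \<open>j\<close> in the directions \<open>a, b, c\<close> and those with
  odd \<open>j\<close> in the opposite directions.
\<close>

lemma exact_steiner_tree_exists:
  fixes a b c :: "'a::euclidean_space"
  assumes n: "3 \<le> n" and eps: "0 \<le> \<epsilon>"
    and unit: "norm a = 1" "norm b = 1" "norm c = 1"
    and inner: "a \<bullet> b = - 1 / 2" "a \<bullet> c = - 1 / 2" "b \<bullet> c = - 1 / 2"
  shows "(approx_steiner_trees \<epsilon> n :: (nat set \<times> nat set set \<times> (nat \<Rightarrow> 'a)) set) \<noteq> {}"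
proof -
  \<comment> \<open>The spine vertex number \<open>j\<close>, reached from the origin by steps \<open>a, - b, a, - b, \<dots>\<close>\<close>
  define P where "P j = real ((j + 1) div 2) *\<^sub>R a - real (j div 2) *\<^sub>R b" for j
  define x where "x v = (if n \<le> v then P (v - n) else if v = n - 1 then P (n - 1)
    else P v + (if even v then c else - c))" for v
  have angle: "vec_angle p q = 2 * pi / 3"
    if "p \<in> {a, b, c}" "q \<in> {a, b, c}" "p \<noteq> q" for p q
    using that unit inner by (intro vec_angle_120) (auto simp: inner_commute)
  have neg: "vec_angle (- p) (- q) = vec_angle p q" for p q :: 'a by (simp add: vec_angle_def)
  have ne: "a \<noteq> b" "a \<noteq> c" "b \<noteq> c"
    using inner unit by (auto simp: norm_eq_1)
  have nz: "a \<noteq> 0" "b \<noteq> 0" "c \<noteq> 0" using unit by auto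
  have "approx_angles \<epsilon> n (caterpillar_vertices n) (caterpillar_edges n) x"
    unfolding approx_angles_def
  proof
    fix s assume "s \<in> caterpillar_vertices n - {1..n}"
    then have s: "n < s" "s \<le> 2 * n - 2" by (auto simp: caterpillar_vertices_def)
    define j where "j = s - n"
    have j: "s = n + j" "1 \<le> j" "j \<le> n - 2" using s by (auto simp: j_def)
    have xs: "x s = P j" "x (s - 1) = P (j - 1)" using j by (auto simp: x_def)
    have xn: "x (caterpillar_next n s) = P (j + 1)"
    proof (cases "j = n - 2")
      case True
      then have "caterpillar_next n s = n - 1" "n - 1 = j + 1" using j n by (auto simp: caterpillar_next_def)
      moreover have "x (n - 1) = P (n - 1)" using n by (simp add: x_def)
      ultimately show ?thesis by simp
    next
      case False
      then have "caterpillar_next n s = s + 1" using j n by (auto simp: caterpillar_next_def)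
      then show ?thesis using j by (simp add: x_def)
    qed
    have xl: "x (s - n) = P j + (if even j then c else - c)" using j n by (auto simp: x_def)
    define g where "g u = (if u = s - n then c else if (u = s - 1) = even j then b else a)" for u
    have nb: "u = s - n \<or> u = s - 1 \<or> u = caterpillar_next n s" if "{s, u} \<in> caterpillar_edges n" for u
      using caterpillar_neighbours_steiner[OF n s] that by (auto simp: neighbours_def)
    have distinct: "s - n \<noteq> s - 1" "s - n \<noteq> caterpillar_next n s" "s - 1 \<noteq> caterpillar_next n s"
      using n s by (auto simp: caterpillar_next_def)
    have diff: "x u - x s = (if even j then g u else - g u)" if "{s, u} \<in> caterpillar_edges n" for u
    proof (cases "even j")
      case True
      then obtain m where "j = 2 * m" "m \<ge> 1" using j(2) by (auto elim!: evenE)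
      then obtain k where k: "j = 2 * Suc k" by (metis One_nat_def Suc_le_D)
      have "P (j + 1) - P j = a" "P (j - 1) - P j = b"
        by (simp_all add: P_def k scaleR_2 algebra_simps)
      then show ?thesis using nb[OF that] distinct xs xn xl True by (auto simp: g_def)
    next
      case False
      then obtain k where k: "j = 2 * k + 1" by (auto elim!: oddE)
      have "P (j + 1) - P j = - b" "P (j - 1) - P j = - a"
        by (simp_all add: P_def k scaleR_2 algebra_simps)
      then show ?thesis using nb[OF that] distinct xs xn xl False by (auto simp: g_def)
    qed
    have "x u \<noteq> x s" if "{s, u} \<in> caterpillar_edges n" for u
      using diff[OF that] nz by (auto simp: g_def split: if_splits)
    moreover have "vec_angle (x u - x s) (x v - x s) \<in> {2 * pi / 3 - \<epsilon>..2 * pi / 3 + \<epsilon>}"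
      if uv: "{s, u} \<in> caterpillar_edges n" "{s, v} \<in> caterpillar_edges n" "u \<noteq> v" for u v
    proof -
      have "vec_angle (x u - x s) (x v - x s) = vec_angle (g u) (g v)"
        using diff[OF uv(1)] diff[OF uv(2)] by (simp add: neg)
      also have "\<dots> = 2 * pi / 3"
        using nb[OF uv(1)] nb[OF uv(2)] uv(3) distinct ne
        by (intro angle) (auto simp: g_def)
      finally show ?thesis using eps by simp
    qed
    ultimately show "(\<forall>u. {s, u} \<in> caterpillar_edges n \<longrightarrow> x u \<noteq> x s) \<and>
        (\<forall>u v. {s, u} \<in> caterpillar_edges n \<and> {s, v} \<in> caterpillar_edges n \<and> u \<noteq> v \<longrightarrow>
           vec_angle (x u - x s) (x v - x s) \<in> {2 * pi / 3 - \<epsilon>..2 * pi / 3 + \<epsilon>})"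
      by blast
  qed
  then have "(caterpillar_vertices n, caterpillar_edges n, x) \<in> approx_steiner_trees \<epsilon> n"
    using caterpillar_topology[OF n] by (simp add: approx_steiner_trees_def)
  then show ?thesis by blast
qed

section \<open>The relative error in the plane\<close>

text \<open>The isometry between the plane and the complex numbers.\<close>

definition to_complex :: "real ^ 2 \<Rightarrow> complex" where
  "to_complex v = Complex (v $ 1) (v $ 2)"

lemma to_complex_diff: "to_complex u - to_complex v = to_complex (u - v)"
  by (simp add: to_complex_def complex_eq_iff)

lemma inner_to_complex: "to_complex u \<bullet> to_complex v = u \<bullet> v"
  by (simp add: to_complex_def inner_complex_def inner_vec_def sum_2)

lemma norm_to_complex: "norm (to_complex u) = norm u"
  by (simp add: norm_eq_sqrt_inner inner_to_complex)

lemma tree_length_to_complex: "tree_length E (\<lambda>v. to_complex (x v)) = tree_length E x"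
  by (simp add: tree_length_def dist_norm to_complex_diff norm_to_complex)

lemma approx_angles_to_complex:
  "approx_angles \<epsilon> n V E (\<lambda>v. to_complex (x v)) = approx_angles \<epsilon> n V E x"
proof -
  have "to_complex u = to_complex v \<longleftrightarrow> u = v" for u v
    using norm_to_complex[of "u - v"] to_complex_diff[of u v] by auto
  then show ?thesis
    by (simp add: approx_angles_def vec_angle_def to_complex_diff norm_to_complex inner_to_complex)
qed

lemma plane_steiner_trees_nonempty:
  assumes "3 \<le> n" "0 \<le> \<epsilon>"
  shows "(approx_steiner_trees \<epsilon> n :: (nat set \<times> nat set set \<times> (nat \<Rightarrow> real ^ 2)) set) \<noteq> {}"
proof (rule exact_steiner_tree_exists[OF assms])
  let ?a = "vector [1, 0] :: real ^ 2" and ?b = "vector [- 1 / 2, sqrt 3 / 2] :: real ^ 2"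
    and ?c = "vector [- 1 / 2, - sqrt 3 / 2] :: real ^ 2"
  show "norm ?a = 1" "norm ?b = 1" "norm ?c = 1"
    by (simp_all add: norm_eq_1 inner_vec_def sum_2)
  show "?a \<bullet> ?b = - 1 / 2" "?a \<bullet> ?c = - 1 / 2" "?b \<bullet> ?c = - 1 / 2"
    by (simp_all add: inner_vec_def sum_2)
qed

lemma rel_error_sup_bound:
  assumes n: "3 \<le> n" and eps: "0 \<le> \<epsilon>" and B: "0 \<le> B"
    and bound: "\<And>V E (x :: nat \<Rightarrow> real ^ 2) y. steiner_topology n V E \<Longrightarrow> full_topology n E \<Longrightarrow>
      approx_angles \<epsilon> n V E x \<Longrightarrow> (\<And>t. t \<in> {1..n} \<Longrightarrow> x t = y t) \<Longrightarrow>
      tree_length E x \<le> (1 + B) * tree_length E y"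
  shows "\<bar>rel_error_sup TYPE(real ^ 2) \<epsilon> n\<bar> \<le> ereal B"
proof -
  let ?A = "approx_steiner_trees \<epsilon> n :: (nat set \<times> nat set set \<times> (nat \<Rightarrow> real ^ 2)) set"
  let ?r = "\<lambda>(V, E, x :: nat \<Rightarrow> real ^ 2).
    ereal (tree_length E x - tree_length E (shortest_tree n E x))
      / ereal (tree_length E (shortest_tree n E x))"
  have ratio: "0 \<le> ?r T \<and> ?r T \<le> ereal B" if "T \<in> ?A" for T
  proof -
    obtain V E x where T: "T = (V, E, x)" and top: "steiner_topology n V E" "full_topology n E"
      "approx_angles \<epsilon> n V E x"
      using \<open>T \<in> ?A\<close> by (auto simp: approx_steiner_trees_def)
    define S where "S = tree_length E (shortest_tree n E x)"
    have tree: "graph_tree V E" "{1..n} \<subseteq> V" "1 \<le> n"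
      using top n by (auto simp: steiner_topology_def)
    have S0: "0 \<le> S" by (simp add: S_def tree_length_nonneg)
    have le: "S \<le> tree_length E x"
      unfolding S_def by (rule shortest_tree_minimal(2)[OF tree]) simp
    have ge: "tree_length E x \<le> (1 + B) * S"
      unfolding S_def
      by (rule bound[OF top]) (simp add: shortest_tree_minimal(1)[OF tree])
    \<comment> \<open>If \<open>S = 0\<close>, the numerator vanishes too, and \<open>0 / 0 = 0\<close> in the extended reals.\<close>
    show ?thesis
    proof (cases "S = 0")
      case True
      then have "tree_length E x = 0" using le ge by simp
      then show ?thesis using B True by (simp add: T S_def[symmetric])
    next
      case False
      then have "S > 0" using S0 by simp
      moreover have "tree_length E x - S \<le> B * S" using ge by (simp add: algebra_simps)
      ultimately show ?thesis using le by (simp add: T S_def[symmetric] divide_le_eq)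
    qed
  qed
  obtain T where T: "T \<in> ?A" using plane_steiner_trees_nonempty[OF n eps] by blast
  have "rel_error_sup TYPE(real ^ 2) \<epsilon> n = (SUP T\<in>?A. ?r T)"
    by (simp add: rel_error_sup_def)
  moreover have "(SUP T\<in>?A. ?r T) \<le> ereal B" by (rule SUP_least) (use ratio in blast)
  moreover have "0 \<le> (SUP T\<in>?A. ?r T)" using SUP_upper2[OF T] ratio[OF T] by blast
  ultimately show ?thesis by simp
qed

text \<open>
  The first claim, for \<open>\<epsilon> = 0\<close> as well. The bounds on \<open>n\<epsilon>\<close> and on \<open>n\<close> that are used here all follow from
  \<open>(n - 2) \<epsilon> < \<pi> < 4\<close>.
\<close>

lemma relative_error_uniform_bound:
  fixes \<delta> :: real
  assumes \<delta>: "\<delta> > 0"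
  shows "\<exists>C\<ge>0. \<forall>n\<ge>3. \<forall>\<epsilon>. 0 \<le> \<epsilon> \<and> \<epsilon> < pi / (real n - 2) \<and> (n = 3 \<longrightarrow> \<epsilon> \<le> 2 * pi / 3 - \<delta>) \<longrightarrow>
     \<bar>rel_error_sup TYPE(real ^ 2) \<epsilon> n\<bar> \<le> ereal (C * (real n)\<^sup>2 * \<epsilon>\<^sup>2)"
proof -
  define \<eta> where "\<eta> = min \<delta> (pi / 6)"
  have \<eta>: "0 < \<eta>" "\<eta> \<le> pi / 2" "\<eta> \<le> \<delta>" "\<eta> \<le> pi / 6" using \<delta> by (auto simp: \<eta>_def min_def)
  have sin: "sin \<eta> > 0" using \<eta> by (intro sin_gt_zero) auto
  \<comment> \<open>For \<open>\<epsilon> > 1 / 100\<close> there are fewer than 402 terminals, so at most 802 vertices.\<close>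
  define K where "K = 3 * (802 :: real)\<^sup>2 * (1 + 3 / sin \<eta>) ^ 802"
  have K0: "K \<ge> 0" using sin by (simp add: K_def)
  define C where "C = 36 + 36 * exp 288 + 10000 * K"
  have C0: "C \<ge> 0" using K0 by (simp add: C_def)
  have "\<bar>rel_error_sup TYPE(real ^ 2) \<epsilon> n\<bar> \<le> ereal (C * (real n)\<^sup>2 * \<epsilon>\<^sup>2)"
    if n: "n \<ge> 3" and eps: "0 \<le> \<epsilon>" "\<epsilon> < pi / (real n - 2)" "n = 3 \<longrightarrow> \<epsilon> \<le> 2 * pi / 3 - \<delta>"
    for n \<epsilon>
  proof (rule rel_error_sup_bound[OF n eps(1)])
    show "0 \<le> C * (real n)\<^sup>2 * \<epsilon>\<^sup>2" using C0 by simp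
    fix V E and x y :: "nat \<Rightarrow> real ^ 2"
    assume top: "steiner_topology n V E" and full: "full_topology n E"
      and angles: "approx_angles \<epsilon> n V E x" and eq: "\<And>t. t \<in> {1..n} \<Longrightarrow> x t = y t"
    let ?x = "\<lambda>v. to_complex (x v)" and ?y = "\<lambda>v. to_complex (y v)"
    have angles': "approx_angles \<epsilon> n V E ?x" using angles by (simp add: approx_angles_to_complex)
    have eq': "?x t = ?y t" if "t \<in> {1..n}" for t using eq[OF that] by simp
    have n1: "1 \<le> n" using n by simp
    define t where "t = (real n)\<^sup>2 * \<epsilon>\<^sup>2"
    have t_sq: "t = (real n * \<epsilon>)\<^sup>2" by (simp add: t_def power_mult_distrib)
    have t0: "0 \<le> t" by (simp add: t_def)
    have pi4: "(real n - 2) * \<epsilon> < 4"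
      using eps(2) n pi_less_4 by (simp add: field_simps)
    have "\<exists>M. tree_length E x \<le> M * tree_length E y \<and> M \<le> 1 + C * t"
    proof -
      consider (small) "real n * \<epsilon> \<le> 1 / 6" | (medium) "1 / 6 < real n * \<epsilon>" "\<epsilon> \<le> 1 / 100"
        | (large) "1 / 100 < \<epsilon>" by linarith
      then show ?thesis
      proof cases
        case small
        have "tree_length E x \<le> (1 + 36 * t) * tree_length E y"
          using relative_error_quadratic[OF top full n1 angles' eq' eps(1) small]
          by (simp add: tree_length_to_complex t_def mult.assoc)
        moreover have "36 * t \<le> C * t" using t0 K0 by (intro mult_right_mono) (auto simp: C_def)
        ultimately show ?thesis by (intro exI[of _ "1 + 36 * t"]) simp
      next
        case medium
        have "real n * \<epsilon> \<le> (3 * (real n - 2)) * \<epsilon>"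
          using n eps(1) by (intro mult_right_mono) auto
        also have "\<dots> = 3 * ((real n - 2) * \<epsilon>)" by (rule mult.assoc)
        also have "\<dots> \<le> 3 * 4" using pi4 by (intro mult_left_mono) auto
        finally have "24 * (real n * \<epsilon>) \<le> 288" by linarith
        then have "24 * real n * \<epsilon> \<le> 288" by (simp only: mult.assoc)
        then have e: "exp (24 * real n * \<epsilon>) \<le> exp 288" by (simp del: exp_le_cancel_iff add: exp_mono)
        have "(1 / 6)\<^sup>2 \<le> t" unfolding t_sq using medium by (intro power_mono) auto
        then have t36: "1 \<le> 36 * t" by (simp add: power2_eq_square)
        have "exp 288 * 1 \<le> exp 288 * (36 * t)" using t36 by (intro mult_left_mono) auto
        also have "\<dots> = (36 * exp 288) * t" by simp
        also have "\<dots> \<le> C * t" using t0 K0 by (intro mult_right_mono) (auto simp: C_def)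
        finally have "exp (24 * real n * \<epsilon>) \<le> 1 + C * t" using e by linarith
        then show ?thesis
          using relative_error_exponential[OF top full n1 angles' eq' eps(1) medium(2)]
          by (auto simp: tree_length_to_complex)
      next
        case large
        have "(real n - 2) * (1 / 100) \<le> (real n - 2) * \<epsilon>"
          using n large by (intro mult_left_mono) auto
        then have "real n < 402" using pi4 by simp
        then have card: "card V \<le> 802"
          using full_topology_card_vertices[OF top full] by linarith
        have lower: "\<eta> \<le> 2 * pi / 3 - \<epsilon>"
        proof (cases "n = 3")
          case False
          then have "real n - 2 \<ge> 2" using n by linarith
          then have "pi / (real n - 2) \<le> pi / 2" by (intro divide_left_mono) auto
          then show ?thesis using eps(2) \<eta>(4) by linarith
        qed (use eps(3) \<eta>(3) in linarith)
        have "tree_length E x \<le>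
            3 * (real (card V))\<^sup>2 * (1 + 3 / sin \<eta>) ^ card V * tree_length E y"
        proof (rule tree_length_le_of_angles_bounded_below[OF top n1 \<eta>(1,2) _ eq])
          show "\<eta> \<le> vec_angle (x u - x s) (x v - x s)"
            if "s \<in> V - {1..n}" "{s, u} \<in> E" "{s, v} \<in> E" "u \<noteq> v" for s u v
            using angles that lower unfolding approx_angles_def by fastforce
        qed
        moreover have "3 * (real (card V))\<^sup>2 * (1 + 3 / sin \<eta>) ^ card V \<le> K"
          unfolding K_def
        proof (intro mult_mono)
          show "(real (card V))\<^sup>2 \<le> 802\<^sup>2" using card by (intro power_mono) auto
          show "(1 + 3 / sin \<eta>) ^ card V \<le> (1 + 3 / sin \<eta>) ^ 802"
            using card sin by (intro power_increasing) auto
        qed (use sin in auto)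
        moreover have "K \<le> 1 + C * t"
        proof -
          have "1 * (1 / 100) \<le> real n * \<epsilon>" using n large by (intro mult_mono) auto
          then have "(1 / 100)\<^sup>2 \<le> t" unfolding t_sq by (intro power_mono) auto
          then have "1 \<le> 10000 * t" by (simp add: power2_eq_square)
          then have "K * 1 \<le> K * (10000 * t)" using K0 by (rule mult_left_mono)
          also have "\<dots> = (10000 * K) * t" by simp
          also have "\<dots> \<le> C * t" using t0 by (intro mult_right_mono) (auto simp: C_def)
          finally show ?thesis by linarith
        qed
        ultimately show ?thesis by (meson order_trans)
      qed
    qed
    then obtain M where M: "tree_length E x \<le> M * tree_length E y" "M \<le> 1 + C * t" by blast
    have "M * tree_length E y \<le> (1 + C * t) * tree_length E y"
      using M(2) by (rule mult_right_mono[OF _ tree_length_nonneg])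
    then show "tree_length E x \<le> (1 + C * (real n)\<^sup>2 * \<epsilon>\<^sup>2) * tree_length E y"
      using M(1) by (simp add: t_def mult.assoc)
  qed
  then show ?thesis using C0 by blast
qed

theorem corollary4p2:
  shows "(\<forall>\<delta>>0. \<exists>C. \<forall>n\<ge>3. \<forall>\<epsilon>. 0 < \<epsilon> \<and> \<epsilon> < pi / (real n - 2) \<and> (n = 3 \<longrightarrow> \<epsilon> \<le> 2 * pi / 3 - \<delta>) \<longrightarrow>
            \<bar>rel_error_sup TYPE(real ^ 2) \<epsilon> n\<bar> \<le> ereal (C * (real n)\<^sup>2 * \<epsilon>\<^sup>2)) \<and>
         (\<forall>\<epsilon> :: nat \<Rightarrow> real.
            (\<forall>\<^sub>F n in sequentially. 0 \<le> \<epsilon> n) \<and> \<epsilon> \<in> O(\<lambda>n. 1 / (real n)\<^sup>2) \<longrightarrow>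
            (\<exists>C. \<forall>\<^sub>F n in sequentially. \<bar>rel_error_sup TYPE(real ^ 2) (\<epsilon> n) n\<bar> \<le> ereal (C * \<epsilon> n)))"
proof (intro conjI allI impI)
  fix \<delta> :: real assume "\<delta> > 0"
  then show "\<exists>C. \<forall>n\<ge>3. \<forall>\<epsilon>. 0 < \<epsilon> \<and> \<epsilon> < pi / (real n - 2) \<and> (n = 3 \<longrightarrow> \<epsilon> \<le> 2 * pi / 3 - \<delta>) \<longrightarrow>
            \<bar>rel_error_sup TYPE(real ^ 2) \<epsilon> n\<bar> \<le> ereal (C * (real n)\<^sup>2 * \<epsilon>\<^sup>2)"
    using relative_error_uniform_bound[of \<delta>] by (meson less_imp_le)
next
  fix \<epsilon> :: "nat \<Rightarrow> real"
  assume *: "(\<forall>\<^sub>F n in sequentially. 0 \<le> \<epsilon> n) \<and> \<epsilon> \<in> O(\<lambda>n. 1 / (real n)\<^sup>2)"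
  \<comment> \<open>The parameter 1 is arbitrary: it plays a role for \<open>n = 3\<close> only.\<close>
  obtain C where C: "C \<ge> 0" "\<And>n \<epsilon>. n \<ge> 3 \<Longrightarrow> 0 \<le> \<epsilon> \<Longrightarrow> \<epsilon> < pi / (real n - 2) \<Longrightarrow>
      (n = 3 \<longrightarrow> \<epsilon> \<le> 2 * pi / 3 - 1) \<Longrightarrow>
      \<bar>rel_error_sup TYPE(real ^ 2) \<epsilon> n\<bar> \<le> ereal (C * (real n)\<^sup>2 * \<epsilon>\<^sup>2)"
    using relative_error_uniform_bound[of 1] by auto
  obtain c where c: "c > 0" "\<forall>\<^sub>F n in sequentially. norm (\<epsilon> n) \<le> c * norm (1 / (real n)\<^sup>2)"
    using * landau_o.bigE by blast
  have "\<forall>\<^sub>F n in sequentially. \<bar>rel_error_sup TYPE(real ^ 2) (\<epsilon> n) n\<bar> \<le> ereal (C * c * \<epsilon> n)"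
    using conjunct1[OF *] c(2) eventually_ge_at_top[of "4 + nat \<lceil>c\<rceil>"]
  proof eventually_elim
    case (elim n)
    have n: "n \<ge> 4" "real n \<ge> c" using elim(3) by linarith+
    have le: "\<epsilon> n \<le> c / (real n)\<^sup>2" using elim(1,2) by simp
    then have sq: "(real n)\<^sup>2 * \<epsilon> n \<le> c" using n by (simp add: field_simps)
    have "c / (real n)\<^sup>2 \<le> real n / (real n)\<^sup>2" using n by (intro divide_right_mono) auto
    also have "\<dots> = 1 / real n" using n by (simp add: power2_eq_square)
    also have "\<dots> \<le> 1 / (real n - 2)" using n by (intro divide_left_mono) auto
    also have "\<dots> < pi / (real n - 2)" using n pi_gt3 by (intro divide_strict_right_mono) auto
    finally have "\<epsilon> n < pi / (real n - 2)" using le by linarith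
    then have "\<bar>rel_error_sup TYPE(real ^ 2) (\<epsilon> n) n\<bar> \<le> ereal (C * (real n)\<^sup>2 * (\<epsilon> n)\<^sup>2)"
      using n elim(1) by (intro C(2)) auto
    also have "C * (real n)\<^sup>2 * (\<epsilon> n)\<^sup>2 = C * (((real n)\<^sup>2 * \<epsilon> n) * \<epsilon> n)"
      by (simp add: power2_eq_square)
    also have "ereal (C * (((real n)\<^sup>2 * \<epsilon> n) * \<epsilon> n)) \<le> ereal (C * (c * \<epsilon> n))"
      using sq elim(1) C(1) by (simp add: mult_left_mono mult_right_mono)
    finally show ?case by (simp add: mult.assoc)
  qed
  then show "\<exists>C. \<forall>\<^sub>F n in sequentially. \<bar>rel_error_sup TYPE(real ^ 2) (\<epsilon> n) n\<bar> \<le> ereal (C * \<epsilon> n)"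
    by blast
qed

end
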